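(* Let $A$ be a local ring with maximal ideal $\mathfrak{m}$, let $M$ be a finitely generated $A$-module, and let $a_1,\ldots,a_r$ be a sequence of elements of $\mathfrak{m}$. Put $\mathfrak{q}_i=(a_1,\ldots,a_i)$ for $i=1,\ldots,r$, $\mathfrak{q}_0=0$, and $\mathfrak{q}=\mathfrak{q}_r$. Then the following conditions are equivalent: (i) $a_1,\ldots,a_r$ is an absolutely superficial $M$-sequence. (ii) For each $i=1,\ldots,r$ there exists an infinite sequence of positive integers $n$ such that $[(\mathfrak{q}_{i-1},\mathfrak{q}^{n+1})M:a_i]\cap\mathfrak{q}M=(\mathfrak{q}_{i-1},\mathfrak{q}^n)M$. (iii) $(\mathfrak{q}_{i-1}M:a_i)\cap\mathfrak{q}(a_i,\ldots,a_r)^nM=\mathfrak{q}_{i-1}(a_i,\ldots,a_r)^nM$ for all $n\ge 0$ and $i=1,\ldots,r$. (iv) $(\mathfrak{q}_{i-1}M:a_i)\cap\mathfrak{q}M=\mathfrak{q}_{i-1}M$ for $i=1,\ldots,r$. (v) $\mathfrak{q}_{i-1}M:a_i^2=\mathfrak{q}_{i-1}M:\mathfrak{q}$ for $i=1,\ldots,r$. (vi) $\mathfrak{q}_{i-1}M:a_i^m=\mathfrak{q}_{i-1}M:\mathfrak{q}^n$ for all $m,n\ge 1$ and $i=1,\ldots,r$. (vii) For $i=1,\ldots,r$: $\mathfrak{q}_{i-1}M:a_i=\bigcup_{n=1}^{\infty}(\mathfrak{q}_{i-1}M:\mathfrak{q}^n)$, and $a_i\notin\mathfrak{p}$ for all $\mathfrak{p}\in\mathrm{Ass}(M/\mathfrak{q}_{i-1}M)\setminus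 V(\mathfrak{q})$.
   Context: Local rings are commutative and Noetherian. For a submodule $N\subseteq M$, an element $a\in A$ and an ideal $\mathfrak{b}\subseteq A$: $N:a=\{x\in M: ax\in N\}$ and $N:\mathfrak{b}=\{x\in M:\mathfrak{b}x\subseteq N\}$. The notation $(\mathfrak{q}_{i-1},\mathfrak{q}^n)$ means the ideal $\mathfrak{q}_{i-1}+\mathfrak{q}^n$; a $0$-th power of an ideal is $A$. $V(\mathfrak{q})$ is the set of prime ideals of $A$ containing $\mathfrak{q}$. Definition: $a_1,\ldots,a_r\in\mathfrak{m}$ is an absolutely superficial $M$-sequence if for each $i=1,\ldots,r$, with $M_{i-1}:=M/\mathfrak{q}_{i-1}M$, one has $(\mathfrak{q}^{n+1}M_{i-1}:a_i)\cap\mathfrak{q}M_{i-1}=\mathfrak{q}^nM_{i-1}$ for all sufficiently large $n$. *)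

theory Defs
  imports "HOL-Algebra.Algebra"
begin

text \<open>
  Modules are those of the locale \<open>module\<close>, whose records extend rings; the fields \<open>mult\<close> and
  \<open>one\<close> of a module record carry no information.
\<close>

locale noetherian_local_ring = cring R + noetherian_ring R for R (structure) +
  fixes m
  assumes maximal: "maximalideal m R"
    and maximal_unique: "\<And>J. maximalideal J R \<Longrightarrow> J = m"

definition finitely_generated_module ::
    "('a, 'c) ring_scheme \<Rightarrow> ('a, 'b, 'd) module_scheme \<Rightarrow> bool" where
  "finitely_generated_module R M \<longleftrightarrow>
     (\<exists>S. finite S \<and> S \<subseteq> carrier M \<and> \<Inter>{N. submodule N R M \<and> S \<subseteq> N} = carrier M)"

text \<open>
  The submodule \<open>I M\<close> of finite sums of products, in the style of \<^const>\<open>ideal_prod\<close>; \<open>I\<close> is meant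
  to be an ideal, so the empty sum needs no rule of its own.
\<close>

inductive_set ideal_smult ::
    "'a set \<Rightarrow> ('a, 'b, 'd) module_scheme \<Rightarrow> 'b set" (infixl \<open>\<star>\<close> 75)
  for I and M where
    smult: "\<lbrakk> c \<in> I; x \<in> carrier M \<rbrakk> \<Longrightarrow> c \<odot>\<^bsub>M\<^esub> x \<in> I \<star> M"
  | sum: "\<lbrakk> x \<in> I \<star> M; y \<in> I \<star> M \<rbrakk> \<Longrightarrow> x \<oplus>\<^bsub>M\<^esub> y \<in> I \<star> M"

definition colon_elem ::
    "('a, 'b, 'd) module_scheme \<Rightarrow> 'b set \<Rightarrow> 'a \<Rightarrow> 'b set" where
  "colon_elem M N c = {x \<in> carrier M. c \<odot>\<^bsub>M\<^esub> x \<in> N}"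

definition colon_ideal ::
    "('a, 'b, 'd) module_scheme \<Rightarrow> 'b set \<Rightarrow> 'a set \<Rightarrow> 'b set" where
  "colon_ideal M N I = {x \<in> carrier M. \<forall>c\<in>I. c \<odot>\<^bsub>M\<^esub> x \<in> N}"

text \<open>
  The quotient \<open>M / N\<close> on additive cosets, with the action \<open>c (N + x) = N + c x\<close>.
\<close>

definition quotient_module ::
    "('a, 'b, 'd) module_scheme \<Rightarrow> 'b set \<Rightarrow> ('a, 'b set) module" where
  "quotient_module M N =
     \<lparr>carrier = a_rcosets\<^bsub>M\<^esub> N, monoid.mult = undefined, one = undefined,
      ring.zero = N, ring.add = set_add M,
      smult = (\<lambda>c Y. \<Union>x\<in>Y. N +>\<^bsub>M\<^esub> (c \<odot>\<^bsub>M\<^esub> x))\<rparr>"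

definition Ass ::
    "('a, 'c) ring_scheme \<Rightarrow> ('a, 'b, 'd) module_scheme \<Rightarrow> 'a set set" where
  "Ass R M = {p. primeideal p R \<and>
     (\<exists>x \<in> carrier M. p = {c \<in> carrier R. c \<odot>\<^bsub>M\<^esub> x = \<zero>\<^bsub>M\<^esub>})}"

definition prime_locus :: "('a, 'c) ring_scheme \<Rightarrow> 'a set \<Rightarrow> 'a set set" where
  "prime_locus R I = {p. primeideal p R \<and> I \<subseteq> p}"

text \<open>
  A sequence \<open>a\<^sub>1, \<dots>, a\<^sub>r\<close> is a function on \<open>nat\<close> of which only the values at \<open>1, \<dots>, r\<close> matter.
  Powers of ideals are taken in the monoid \<^term>\<open>ideals_set R\<close>, whose unit is \<^term>\<open>carrier R\<close>.
\<close>

definition absolutely_superficial ::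
    "('a, 'c) ring_scheme \<Rightarrow> 'a set \<Rightarrow> ('a, 'b, 'd) module_scheme \<Rightarrow> nat \<Rightarrow> (nat \<Rightarrow> 'a) \<Rightarrow> bool" where
  "absolutely_superficial R m M r a \<longleftrightarrow>
     (\<forall>i\<in>{1..r}. a i \<in> m) \<and>
     (\<forall>i\<in>{1..r}.
        let q = Idl\<^bsub>R\<^esub> (a ` {1..r});
            M' = quotient_module M (Idl\<^bsub>R\<^esub> (a ` {1..i - 1}) \<star> M)
        in \<forall>\<^sub>F n :: nat in sequentially.
             colon_elem M' ((q [^]\<^bsub>ideals_set R\<^esub> (n + 1)) \<star> M') (a i) \<inter> q \<star> M' =
             (q [^]\<^bsub>ideals_set R\<^esub> n) \<star> M')"

definition all_equivalent :: "bool list \<Rightarrow> bool" where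
  "all_equivalent Ps \<longleftrightarrow> (\<forall>P\<in>set Ps. \<forall>Q\<in>set Ps. P \<longleftrightarrow> Q)"

context module
begin

lemma quotient_module_coset:
  assumes N: "submodule N R M" and x: "x \<in> carrier M"
  shows "N +>\<^bsub>M\<^esub> x \<in> carrier (quotient_module M N)"
  using x by (auto simp: quotient_module_def A_RCOSETS_def')

lemma quotient_module_add:
  assumes N: "submodule N R M" and x: "x \<in> carrier M" and y: "y \<in> carrier M"
  shows "(N +>\<^bsub>M\<^esub> x) \<oplus>\<^bsub>quotient_module M N\<^esub> (N +>\<^bsub>M\<^esub> y) = N +>\<^bsub>M\<^esub> (x \<oplus>\<^bsub>M\<^esub> y)"
proof -
  interpret N: abelian_subgroup N M
    by (intro abelian_subgroupI3 additive_subgroup.intro submodule.axioms(1)[OF N]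
        M.abelian_group_axioms)
  show ?thesis
    using N.a_rcos_sum[OF x y] by (simp add: quotient_module_def)
qed

lemma quotient_module_smult:
  assumes N: "submodule N R M" and c: "c \<in> carrier R" and x: "x \<in> carrier M"
  shows "c \<odot>\<^bsub>quotient_module M N\<^esub> (N +>\<^bsub>M\<^esub> x) = N +>\<^bsub>M\<^esub> (c \<odot>\<^bsub>M\<^esub> x)"
proof -
  interpret N: abelian_subgroup N M
    by (intro abelian_subgroupI3 additive_subgroup.intro submodule.axioms(1)[OF N]
        M.abelian_group_axioms)
  have "N +>\<^bsub>M\<^esub> (c \<odot>\<^bsub>M\<^esub> y) = N +>\<^bsub>M\<^esub> (c \<odot>\<^bsub>M\<^esub> x)" if y: "y \<in> N +>\<^bsub>M\<^esub> x" for y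
  proof -
    obtain h where h: "h \<in> N" "y = h \<oplus>\<^bsub>M\<^esub> x"
      using y by (auto simp: a_r_coset_def')
    have ch: "c \<odot>\<^bsub>M\<^esub> h \<in> N"
      using submodule.smult_closed[OF N c h(1)] .
    have "c \<odot>\<^bsub>M\<^esub> y = c \<odot>\<^bsub>M\<^esub> h \<oplus>\<^bsub>M\<^esub> c \<odot>\<^bsub>M\<^esub> x"
      using h c x N.a_Hcarr by (simp add: smult_r_distr)
    then have "c \<odot>\<^bsub>M\<^esub> y \<in> N +>\<^bsub>M\<^esub> (c \<odot>\<^bsub>M\<^esub> x)"
      using ch by (auto simp: a_r_coset_def')
    then show ?thesis
      using M.a_repr_independence'[of "c \<odot>\<^bsub>M\<^esub> y" N "c \<odot>\<^bsub>M\<^esub> x"] c x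
        submodule.axioms(1)[OF N] by (simp add: a_r_coset_def)
  qed
  then have "(\<Union>y\<in>N +>\<^bsub>M\<^esub> x. N +>\<^bsub>M\<^esub> (c \<odot>\<^bsub>M\<^esub> y)) =
      (\<Union>y\<in>N +>\<^bsub>M\<^esub> x. N +>\<^bsub>M\<^esub> (c \<odot>\<^bsub>M\<^esub> x))"
    by (rule SUP_cong[OF refl])
  also have "\<dots> = N +>\<^bsub>M\<^esub> (c \<odot>\<^bsub>M\<^esub> x)"
    using N.a_rcos_self[OF x] by blast
  finally show ?thesis
    by (simp add: quotient_module_def)
qed

lemma module_quotient_module:
  assumes N: "submodule N R M"
  shows "module R (quotient_module M N)"
proof -
  interpret N: abelian_subgroup N M
    by (intro abelian_subgroupI3 additive_subgroup.intro submodule.axioms(1)[OF N]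
        M.abelian_group_axioms)
  have repr: "\<exists>x\<in>carrier M. Y = N +>\<^bsub>M\<^esub> x" if "Y \<in> carrier (quotient_module M N)" for Y
    using that by (auto simp: quotient_module_def A_RCOSETS_def')
  note ops = quotient_module_add[OF N] quotient_module_smult[OF N] quotient_module_coset[OF N]
  show ?thesis
  proof (rule moduleI)
    show "cring R" ..
    show "abelian_group (quotient_module M N)"
    proof (rule abelian_groupI)
      have zero: "\<zero>\<^bsub>quotient_module M N\<^esub> = N +>\<^bsub>M\<^esub> \<zero>\<^bsub>M\<^esub>"
        using M.a_coset_add_zero[of N] N.a_subset by (simp add: quotient_module_def)
      show "\<zero>\<^bsub>quotient_module M N\<^esub> \<in> carrier (quotient_module M N)"
        using ops(3) by (simp add: zero)
      show "\<zero>\<^bsub>quotient_module M N\<^esub> \<oplus>\<^bsub>quotient_module M N\<^esub> Y = Y"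
        if "Y \<in> carrier (quotient_module M N)" for Y
        using repr[OF that] by (auto simp: zero ops)
      show "\<exists>Z\<in>carrier (quotient_module M N).
          Z \<oplus>\<^bsub>quotient_module M N\<^esub> Y = \<zero>\<^bsub>quotient_module M N\<^esub>"
        if Y: "Y \<in> carrier (quotient_module M N)" for Y
      proof -
        obtain x where x: "x \<in> carrier M" "Y = N +>\<^bsub>M\<^esub> x"
          using repr[OF Y] by blast
        show ?thesis
          by (rule bexI[of _ "N +>\<^bsub>M\<^esub> (\<ominus>\<^bsub>M\<^esub> x)"]) (use x in \<open>simp_all add: zero ops M.l_neg\<close>)
      qed
    next
      fix Y Z W
      assume "Y \<in> carrier (quotient_module M N)" "Z \<in> carrier (quotient_module M N)"
        "W \<in> carrier (quotient_module M N)"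
      then obtain x y z where "x \<in> carrier M" "y \<in> carrier M" "z \<in> carrier M"
        "Y = N +>\<^bsub>M\<^esub> x" "Z = N +>\<^bsub>M\<^esub> y" "W = N +>\<^bsub>M\<^esub> z"
        by (meson repr)
      then show "Y \<oplus>\<^bsub>quotient_module M N\<^esub> Z \<oplus>\<^bsub>quotient_module M N\<^esub> W =
          Y \<oplus>\<^bsub>quotient_module M N\<^esub> (Z \<oplus>\<^bsub>quotient_module M N\<^esub> W)"
        by (simp add: ops M.a_assoc)
    next
      fix Y Z
      assume "Y \<in> carrier (quotient_module M N)" "Z \<in> carrier (quotient_module M N)"
      then obtain x y where xy: "x \<in> carrier M" "y \<in> carrier M"
        "Y = N +>\<^bsub>M\<^esub> x" "Z = N +>\<^bsub>M\<^esub> y"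
        by (meson repr)
      then show "Y \<oplus>\<^bsub>quotient_module M N\<^esub> Z \<in> carrier (quotient_module M N)"
        by (simp add: ops)
      show "Y \<oplus>\<^bsub>quotient_module M N\<^esub> Z = Z \<oplus>\<^bsub>quotient_module M N\<^esub> Y"
        using xy by (simp add: ops M.a_comm)
    qed
  next
    fix Y
    assume "Y \<in> carrier (quotient_module M N)"
    then obtain x where x: "x \<in> carrier M" "Y = N +>\<^bsub>M\<^esub> x"
      by (meson repr)
    show "\<one> \<odot>\<^bsub>quotient_module M N\<^esub> Y = Y"
      using x by (simp add: ops)
    fix c assume c: "c \<in> carrier R"
    show "c \<odot>\<^bsub>quotient_module M N\<^esub> Y \<in> carrier (quotient_module M N)"
      using c x by (simp add: ops)
    fix d assume d: "d \<in> carrier R"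
    show "(c \<oplus> d) \<odot>\<^bsub>quotient_module M N\<^esub> Y =
        c \<odot>\<^bsub>quotient_module M N\<^esub> Y \<oplus>\<^bsub>quotient_module M N\<^esub> d \<odot>\<^bsub>quotient_module M N\<^esub> Y"
      using c d x by (simp add: ops smult_l_distr)
    show "(c \<otimes> d) \<odot>\<^bsub>quotient_module M N\<^esub> Y =
        c \<odot>\<^bsub>quotient_module M N\<^esub> (d \<odot>\<^bsub>quotient_module M N\<^esub> Y)"
      using c d x by (simp add: ops smult_assoc1)
  next
    fix c Y Z
    assume c: "c \<in> carrier R"
      and "Y \<in> carrier (quotient_module M N)" "Z \<in> carrier (quotient_module M N)"
    then obtain x y where xy: "x \<in> carrier M" "y \<in> carrier M"
      "Y = N +>\<^bsub>M\<^esub> x" "Z = N +>\<^bsub>M\<^esub> y"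
      by (meson repr)
    then show "c \<odot>\<^bsub>quotient_module M N\<^esub> (Y \<oplus>\<^bsub>quotient_module M N\<^esub> Z) =
        c \<odot>\<^bsub>quotient_module M N\<^esub> Y \<oplus>\<^bsub>quotient_module M N\<^esub> c \<odot>\<^bsub>quotient_module M N\<^esub> Z"
      using c by (simp add: ops smult_r_distr)
  qed
qed

end

end

theory Submission
  imports Defs
begin

text \<open>
  Write \<open>q\<^sub>j = (a\<^sub>1, \<dots>, a\<^sub>j)\<close> and \<open>q = q\<^sub>r\<close>. Everything is compared with condition (iv), called
  \<open>relatively_regular\<close> below. It yields (v) and (vi) because \<open>a\<^sub>i x \<in> q\<^sub>i\<^sub>-\<^sub>1M\<close> gives
  \<open>a\<^sub>j x \<in> (q\<^sub>i\<^sub>-\<^sub>1M : a\<^sub>i) \<inter> qM\<close>; conversely an element of \<open>qM = q\<^sub>rM\<close> killed by \<open>q\<close> modulo \<open>q\<^sub>i\<^sub>-\<^sub>1M\<close> is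
  pushed down through \<open>q\<^sub>kM\<close>, \<open>k = r - 1, \<dots>, i - 1\<close>, using \<open>q\<^sub>kM : a\<^sub>k\<^sub>+\<^sub>1\<^sup>2 = q\<^sub>kM : q\<close>.
  Conditions (i)-(iii) follow from
  \<open>q\<^sub>i\<^sub>-\<^sub>1M \<inter> (a\<^sub>i, \<dots>, a\<^sub>r)\<^sup>n\<^sup>+\<^sup>1M \<subseteq> q\<^sub>i\<^sub>-\<^sub>1(a\<^sub>i, \<dots>, a\<^sub>r)\<^sup>nM\<close>, proved by descending induction on \<open>i\<close> and
  induction on \<open>n\<close>. Krull's intersection theorem leads from (ii) back to (iv). In (vii), the
  condition on associated primes says that \<open>q\<^sub>i\<^sub>-\<^sub>1M : a\<^sub>i\<^sup>2\<close> lies in \<open>\<Union>\<^sub>n (q\<^sub>i\<^sub>-\<^sub>1M : q\<^sup>n)\<close>, and the same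
  descent gives (v).
\<close>

section \<open>Ideals\<close>

text \<open>Condition (iv) is a suitable hub because it is a cancellation rule: modulo q_jM, a
  factor a_(j+1) may be dropped from vectors of qM. Every argument that starts from it first
  arranges for the vector in question to lie in qM; this is why powers of tail ideals appear with
  exponent at least 1, and why colon arguments first multiply by an element of q.

  No chain condition on submodules of M is established. Stationary chains and maximal annihilators
  are sought among ideals of the ring, mostly ideals (P : y) for a vector y; Zorn's lemma supplies
  the one maximal submodule that occurs.

  The obstacle in (vii) is that it speaks of the saturation of q_(i-1)M and not of q_(i-1)M : q. A
  vector x with a_i^2 x in q_(i-1)M is at first only known to be killed by some power of q; that
  every a_k x lies in q_(i-1)M has to be recovered by a descent inside the saturation of
  q_(i-1)M.\<close>

lemma (in noetherian_ring) exists_maximal_ideal_in_family: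
  assumes "F \<noteq> {}" and ideals: "\<And>I. I \<in> F \<Longrightarrow> ideal I R"
  shows "\<exists>I\<in>F. \<forall>J\<in>F. I \<subseteq> J \<longrightarrow> J = I"
proof (rule subset_Zorn_nonempty[OF assms(1)])
  \<comment> \<open>By \<open>ideal_chain_is_trivial\<close> a nonempty chain of ideals contains its
    own union, so an arbitrary family \<open>F\<close> satisfies the premise of Zorn's
    lemma.\<close>
  show "\<Union>C \<in> F" if C: "C \<noteq> {}" "subset.chain F C" for C
  proof -
    have "subset.chain {I. ideal I R} C"
      using C(2) ideals by (auto simp: pred_on.chain_def)
    then show ?thesis
      using ideal_chain_is_trivial[OF C(1)] C(2) by (auto simp: pred_on.chain_def)
  qed
qed

lemma (in noetherian_ring) ascending_ideals_stationary:
  fixes I :: "nat \<Rightarrow> 'a set"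
  assumes "\<And>n. ideal (I n) R" and "\<And>n. I n \<subseteq> I (Suc n)"
  shows "\<exists>n. I (Suc n) = I n"
proof -
  have "\<exists>K\<in>range I. \<forall>J\<in>range I. K \<subseteq> J \<longrightarrow> J = K"
    by (rule exists_maximal_ideal_in_family) (use assms(1) in auto)
  then obtain K where K: "K \<in> range I" "\<forall>J\<in>range I. K \<subseteq> J \<longrightarrow> J = K"
    by (rule bexE)
  obtain n where n: "K = I n"
    using K(1) by (rule rangeE)
  have "I (Suc n) = K"
    using K(2)[rule_format, OF rangeI, of "Suc n"] assms(2)[of n] unfolding n by simp
  with n have "I (Suc n) = I n"
    by simp
  then show ?thesis ..
qed

text \<open>The family of proper ideals above \<open>I\<close> has a maximal member, and uniqueness
  identifies it with \<open>m\<close>. This stands in for the fact that elements outside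
  \<open>m\<close> are units.\<close>

lemma (in noetherian_local_ring) proper_ideal_subset_maximal:
  assumes I: "ideal I R" and proper: "\<one> \<notin> I"
  shows "I \<subseteq> m"
proof -
  let ?F = "{J. ideal J R \<and> I \<subseteq> J \<and> \<one> \<notin> J}"
  have "\<exists>J\<in>?F. \<forall>K\<in>?F. J \<subseteq> K \<longrightarrow> K = J"
    by (rule exists_maximal_ideal_in_family) (use assms in auto)
  then obtain J where J: "J \<in> ?F" "\<And>K. \<lbrakk>K \<in> ?F; J \<subseteq> K\<rbrakk> \<Longrightarrow> K = J"
    by meson
  have "maximalideal J R"
  proof (rule maximalidealI)
    show "ideal J R" "carrier R \<noteq> J"
      using J(1) by auto
    show "K = J \<or> K = carrier R" if "ideal K R" "J \<subseteq> K" "K \<subseteq> carrier R" for K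
      using J that ideal.one_imp_carrier[OF that(1)] by blast
  qed
  then show ?thesis
    using maximal_unique J(1) by auto
qed

lemma (in noetherian_local_ring) one_notin_maximal: "\<one> \<notin> m"
  using maximal ideal.one_imp_carrier[of m R] maximalideal.I_notcarr[of m R]
  by (auto simp: maximalideal_def)

lemma (in ring) genideal_Un:
  assumes S: "S \<subseteq> carrier R" and T: "T \<subseteq> carrier R"
  shows "Idl (S \<union> T) = Idl S <+> Idl T"
proof -
  have "Idl (S \<union> T) = Idl (Idl S \<union> Idl T)"
  proof (rule equalityI; rule genideal_minimal)
    have "Idl S \<union> Idl T \<subseteq> carrier R"
      using genideal_ideal[OF S] genideal_ideal[OF T]
      by (meson Un_least ideal.axioms(1) additive_subgroup.a_subset)
    then show "ideal (Idl (Idl S \<union> Idl T)) R" "S \<union> T \<subseteq> Idl (Idl S \<union> Idl T)"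
      using genideal_self[OF S] genideal_self[OF T] genideal_self genideal_ideal by blast+
    show "ideal (Idl (S \<union> T)) R"
      using S T by (simp add: genideal_ideal)
    then show "Idl S \<union> Idl T \<subseteq> Idl (S \<union> T)"
      using S T genideal_self[of "S \<union> T"] by (simp add: Idl_subset_ideal)
  qed
  then show ?thesis
    by (simp add: union_genideal genideal_ideal assms)
qed

lemma (in ring) genideal_empty: "Idl {} = {\<zero>}"
  by (rule equalityI)
    (use genideal_minimal[OF zeroideal] genideal_ideal[of "{}"] in
      \<open>auto simp: ideal_def additive_subgroup.zero_closed\<close>)

lemma mult_ideals_set [simp]: "I \<otimes>\<^bsub>ideals_set R\<^esub> J = I \<cdot>\<^bsub>R\<^esub> J"
  by (simp add: ideals_set_def)

lemma one_ideals_set [simp]: "\<one>\<^bsub>ideals_set R\<^esub> = carrier R"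
  by (simp add: ideals_set_def)

lemma (in cring) ideal_power_is_ideal:
  assumes "ideal I R"
  shows "ideal (I [^]\<^bsub>ideals_set R\<^esub> (n::nat)) R"
  by (induction n) (simp_all add: oneideal ideal_prod_is_ideal assms)

text \<open>The recursion of powers appends the new factor on the right, while the splitting lemmas
  below peel factors off on the left.\<close>

lemma (in cring) ideal_power_Suc_left:
  assumes "ideal I R"
  shows "I [^]\<^bsub>ideals_set R\<^esub> Suc n = I \<cdot> (I [^]\<^bsub>ideals_set R\<^esub> n)"
  using ideal_prod_commute[OF assms ideal_power_is_ideal[OF assms, of n]]
  by simp

lemma (in cring) ideal_power_antimono:
  fixes k n :: nat
  assumes I: "ideal I R" and "k \<le> n"
  shows "I [^]\<^bsub>ideals_set R\<^esub> n \<subseteq> I [^]\<^bsub>ideals_set R\<^esub> k"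
  using \<open>k \<le> n\<close>
  by (induction n rule: dec_induct)
    (use ideal_prod_inter[OF ideal_power_is_ideal[OF I] I] in auto)

lemma ideal_prod_mono: "\<lbrakk>I \<subseteq> I'; K \<subseteq> K'\<rbrakk> \<Longrightarrow> I \<cdot>\<^bsub>R\<^esub> K \<subseteq> I' \<cdot>\<^bsub>R\<^esub> K'"
proof
  show "x \<in> I' \<cdot>\<^bsub>R\<^esub> K'" if "I \<subseteq> I'" "K \<subseteq> K'" "x \<in> I \<cdot>\<^bsub>R\<^esub> K" for x
    using that(3) by induction (use that in \<open>auto intro: ideal_prod.intros\<close>)
qed

lemma (in cring) ideal_power_mono:
  assumes "I \<subseteq> K"
  shows "I [^]\<^bsub>ideals_set R\<^esub> (n::nat) \<subseteq> K [^]\<^bsub>ideals_set R\<^esub> n"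
  by (induction n) (simp_all add: ideal_prod_mono assms)

section \<open>Submodules, products and colons\<close>

context module
begin

lemma submodule_in_carrier: "\<lbrakk>submodule N R M; x \<in> N\<rbrakk> \<Longrightarrow> x \<in> carrier M"
  using submoduleE(1) by blast

lemma submodule_zero: "submodule N R M \<Longrightarrow> \<zero>\<^bsub>M\<^esub> \<in> N"
  using subgroup.one_closed[OF submodule.axioms(1)] by fastforce

lemma submodule_add_cancel_right:
  assumes N: "submodule N R M" and "x \<in> carrier M" "y \<in> N" "x \<oplus>\<^bsub>M\<^esub> y \<in> N"
  shows "x \<in> N"
proof -
  have "x = (x \<oplus>\<^bsub>M\<^esub> y) \<oplus>\<^bsub>M\<^esub> \<ominus>\<^bsub>M\<^esub> y"
    using assms submodule_in_carrier[OF N] by (simp add: M.a_assoc M.r_neg)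
  then show ?thesis
    using assms submoduleE[OF N] by metis
qed

lemma submodule_add_cancel_left:
  assumes N: "submodule N R M" and "x \<in> carrier M" "y \<in> N" "y \<oplus>\<^bsub>M\<^esub> x \<in> N"
  shows "x \<in> N"
  using submodule_add_cancel_right[OF N, of x y] assms submodule_in_carrier[OF N]
  by (simp add: M.a_comm)

lemma add_add_swap:
  "\<lbrakk>x \<in> carrier M; y \<in> carrier M; x' \<in> carrier M; y' \<in> carrier M\<rbrakk> \<Longrightarrow>
    (x \<oplus>\<^bsub>M\<^esub> y) \<oplus>\<^bsub>M\<^esub> (x' \<oplus>\<^bsub>M\<^esub> y') = (x \<oplus>\<^bsub>M\<^esub> x') \<oplus>\<^bsub>M\<^esub> (y \<oplus>\<^bsub>M\<^esub> y')"
  by (simp add: M.add.m_ac)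

lemma smult_commute:
  "\<lbrakk>c \<in> carrier R; d \<in> carrier R; x \<in> carrier M\<rbrakk> \<Longrightarrow>
    c \<odot>\<^bsub>M\<^esub> (d \<odot>\<^bsub>M\<^esub> x) = d \<odot>\<^bsub>M\<^esub> (c \<odot>\<^bsub>M\<^esub> x)"
  by (metis R.m_comm smult_assoc1)

text \<open>This is the annihilator of the class of \<open>x\<close> in M/N. Through it the chain
  condition on ideals of the ring is brought to bear on vectors.\<close>

lemma ideal_of_vector_colon:
  assumes N: "submodule N R M" and x: "x \<in> carrier M"
  shows "ideal {c \<in> carrier R. c \<odot>\<^bsub>M\<^esub> x \<in> N} R"
proof (rule idealI)
  show "ring R" ..
  show "subgroup {c \<in> carrier R. c \<odot>\<^bsub>M\<^esub> x \<in> N} (add_monoid R)"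
  proof (rule R.add.subgroupI)
    have "\<zero>\<^bsub>R\<^esub> \<in> {c \<in> carrier R. c \<odot>\<^bsub>M\<^esub> x \<in> N}"
      using x submodule_zero[OF N] by simp
    then show "{c \<in> carrier R. c \<odot>\<^bsub>M\<^esub> x \<in> N} \<noteq> {}"
      by blast
  qed (use submoduleE(3,5)[OF N] x in
      \<open>auto simp: smult_l_distr smult_l_minus a_inv_def[symmetric]\<close>)
  show "d \<otimes>\<^bsub>R\<^esub> c \<in> {c \<in> carrier R. c \<odot>\<^bsub>M\<^esub> x \<in> N}"
    "c \<otimes>\<^bsub>R\<^esub> d \<in> {c \<in> carrier R. c \<odot>\<^bsub>M\<^esub> x \<in> N}"
    if "c \<in> {c \<in> carrier R. c \<odot>\<^bsub>M\<^esub> x \<in> N}" "d \<in> carrier R" for c d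
    using that submoduleE(4)[OF N] x R.m_comm[of c d] by (auto simp: smult_assoc1)
qed

lemma submodule_colon_ideal:
  assumes N: "submodule N R M" and I: "I \<subseteq> carrier R"
  shows "submodule (colon_ideal M N I) R M"
  by (rule submoduleI)
    (use submodule_zero[OF N] submoduleE[OF N] subsetD[OF I] in
      \<open>auto simp: colon_ideal_def smult_r_distr smult_r_minus smult_commute\<close>)

text \<open>The multipliers that carry a fixed \<open>x\<close> into \<open>N\<close> form an ideal,
  so generators suffice as tests. Colons by q thereby reduce to finitely many conditions on the
  \<open>a i\<close>.\<close>

lemma colon_ideal_genideal:
  assumes N: "submodule N R M" and S: "S \<subseteq> carrier R"
  shows "colon_ideal M N (Idl\<^bsub>R\<^esub> S) = colon_ideal M N S"
proof
  have "Idl\<^bsub>R\<^esub> S \<subseteq> {c \<in> carrier R. c \<odot>\<^bsub>M\<^esub> x \<in> N}"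
    if "x \<in> colon_ideal M N S" for x
    by (rule R.genideal_minimal[OF ideal_of_vector_colon[OF N]])
      (use that S in \<open>auto simp: colon_ideal_def\<close>)
  then show "colon_ideal M N S \<subseteq> colon_ideal M N (Idl\<^bsub>R\<^esub> S)"
    unfolding colon_ideal_def by blast
  show "colon_ideal M N (Idl\<^bsub>R\<^esub> S) \<subseteq> colon_ideal M N S"
    using R.genideal_self[OF S] unfolding colon_ideal_def by blast
qed

lemma colon_ideal_ideal_prod:
  assumes N: "submodule N R M" and I: "ideal I R" and K: "ideal K R"
  shows "colon_ideal M N (I \<cdot>\<^bsub>R\<^esub> K) = colon_ideal M (colon_ideal M N I) K"
proof (rule equalityI; rule subsetI)
  fix x assume "x \<in> colon_ideal M N (I \<cdot>\<^bsub>R\<^esub> K)"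
  then show "x \<in> colon_ideal M (colon_ideal M N I) K"
    using ideal.Icarr[OF I] ideal.Icarr[OF K]
    by (auto simp: colon_ideal_def smult_assoc1[symmetric] intro: ideal_prod.prod)
next
  fix x assume x: "x \<in> colon_ideal M (colon_ideal M N I) K"
  have "c \<in> carrier R \<and> c \<odot>\<^bsub>M\<^esub> x \<in> N" if "c \<in> I \<cdot>\<^bsub>R\<^esub> K" for c
    using that
  proof induction
    case (prod i j)
    then show ?case
      using x ideal.Icarr[OF I] ideal.Icarr[OF K] by (auto simp: colon_ideal_def smult_assoc1)
  next
    case (sum c d)
    then show ?case
      using x submoduleE(5)[OF N] by (auto simp: colon_ideal_def smult_l_distr)
  qed
  then show "x \<in> colon_ideal M N (I \<cdot>\<^bsub>R\<^esub> K)"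
    using x by (simp add: colon_ideal_def)
qed

lemma submodule_ideal_smult:
  assumes I: "ideal I R"
  shows "submodule (I \<star> M) R M"
proof -
  have closed: "x \<in> carrier M" if "x \<in> I \<star> M" for x
    using that by induction (use ideal.Icarr[OF I] in auto)
  show ?thesis
  proof (rule submoduleI)
    show "I \<star> M \<subseteq> carrier M"
      using closed by blast
    show "\<zero>\<^bsub>M\<^esub> \<in> I \<star> M"
      using ideal_smult.smult[of "\<zero>\<^bsub>R\<^esub>" I "\<zero>\<^bsub>M\<^esub>" M] I
      by (simp add: ideal_def additive_subgroup.zero_closed)
    show "x \<oplus>\<^bsub>M\<^esub> y \<in> I \<star> M" if "x \<in> I \<star> M" "y \<in> I \<star> M" for x y
      using that by (rule ideal_smult.sum)
    show smult: "c \<odot>\<^bsub>M\<^esub> x \<in> I \<star> M" if "c \<in> carrier R" "x \<in> I \<star> M" for c x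
      using that(2)
    proof induction
      case (smult d x)
      then show ?case
        using that(1) ideal.Icarr[OF I] ideal.I_l_closed[OF I] ideal_smult.smult[of "c \<otimes>\<^bsub>R\<^esub> d" I x M]
        by (simp add: smult_assoc1)
    next
      case (sum x y)
      then show ?case
        using that(1) closed by (simp add: smult_r_distr ideal_smult.sum)
    qed
    show "\<ominus>\<^bsub>M\<^esub> x \<in> I \<star> M" if "x \<in> I \<star> M" for x
      using smult[of "\<ominus>\<^bsub>R\<^esub> \<one>\<^bsub>R\<^esub>", OF _ that] closed[OF that] by (simp add: smult_l_minus)
  qed
qed

lemma ideal_smult_mono: "I \<subseteq> K \<Longrightarrow> I \<star> M \<subseteq> K \<star> M"
proof
  show "x \<in> K \<star> M" if "I \<subseteq> K" "x \<in> I \<star> M" for x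
    using that(2) by induction (use that in \<open>auto intro: ideal_smult.intros\<close>)
qed

lemma zero_ideal_smult:
  assumes "x \<in> {\<zero>\<^bsub>R\<^esub>} \<star> M"
  shows "x = \<zero>\<^bsub>M\<^esub>"
  using assms by induction auto

lemma carrier_ideal_smult: "carrier R \<star> M = carrier M"
  using submoduleE(1)[OF submodule_ideal_smult[OF R.oneideal]]
    ideal_smult.smult[of "\<one>\<^bsub>R\<^esub>" "carrier R" _ M] by auto

lemma ideal_smult_add_iff:
  assumes I: "ideal I R" and K: "ideal K R"
  shows "x \<in> (I <+>\<^bsub>R\<^esub> K) \<star> M \<longleftrightarrow> (\<exists>y \<in> I \<star> M. \<exists>z \<in> K \<star> M. x = y \<oplus>\<^bsub>M\<^esub> z)"
proof
  note IM = submodule_in_carrier[OF submodule_ideal_smult[OF I]]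
  note KM = submodule_in_carrier[OF submodule_ideal_smult[OF K]]
  assume "x \<in> (I <+>\<^bsub>R\<^esub> K) \<star> M"
  then show "\<exists>y \<in> I \<star> M. \<exists>z \<in> K \<star> M. x = y \<oplus>\<^bsub>M\<^esub> z"
  proof induction
    case (smult c x)
    then obtain d e where "d \<in> I" "e \<in> K" "c = d \<oplus>\<^bsub>R\<^esub> e"
      by (auto simp: set_add_def')
    then have "c \<odot>\<^bsub>M\<^esub> x = d \<odot>\<^bsub>M\<^esub> x \<oplus>\<^bsub>M\<^esub> e \<odot>\<^bsub>M\<^esub> x"
      using smult ideal.Icarr[OF I] ideal.Icarr[OF K] by (simp add: smult_l_distr)
    then show ?case
      using smult \<open>d \<in> I\<close> \<open>e \<in> K\<close> by (blast intro: ideal_smult.smult)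
  next
    case (sum x x')
    then obtain y z y' z' where "y \<in> I \<star> M" "z \<in> K \<star> M" "x = y \<oplus>\<^bsub>M\<^esub> z"
      "y' \<in> I \<star> M" "z' \<in> K \<star> M" "x' = y' \<oplus>\<^bsub>M\<^esub> z'"
      by blast
    moreover from this have "x \<oplus>\<^bsub>M\<^esub> x' = (y \<oplus>\<^bsub>M\<^esub> y') \<oplus>\<^bsub>M\<^esub> (z \<oplus>\<^bsub>M\<^esub> z')"
      by (simp add: add_add_swap IM KM)
    ultimately show ?case
      by (blast intro: ideal_smult.sum)
  qed
next
  have "Idl\<^bsub>R\<^esub> (I \<union> K) = I <+>\<^bsub>R\<^esub> K"
    by (rule R.union_genideal[OF I K])
  moreover have "I \<union> K \<subseteq> carrier R"
    using ideal.Icarr[OF I] ideal.Icarr[OF K] by blast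
  ultimately have "I \<subseteq> I <+>\<^bsub>R\<^esub> K" "K \<subseteq> I <+>\<^bsub>R\<^esub> K"
    using R.genideal_self by blast+
  then have "I \<star> M \<subseteq> (I <+>\<^bsub>R\<^esub> K) \<star> M" "K \<star> M \<subseteq> (I <+>\<^bsub>R\<^esub> K) \<star> M"
    by (simp_all add: ideal_smult_mono)
  then show "x \<in> (I <+>\<^bsub>R\<^esub> K) \<star> M" if "\<exists>y \<in> I \<star> M. \<exists>z \<in> K \<star> M. x = y \<oplus>\<^bsub>M\<^esub> z"
    using that by (auto intro: ideal_smult.sum)
qed

lemma ideal_smult_prod:
  assumes I: "ideal I R" and K: "ideal K R" and c: "c \<in> I" and y: "y \<in> K \<star> M"
  shows "c \<odot>\<^bsub>M\<^esub> y \<in> (I \<cdot>\<^bsub>R\<^esub> K) \<star> M"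
  using y
proof induction
  case (smult d x)
  then show ?case
    using c ideal.Icarr[OF I] ideal.Icarr[OF K]
    by (auto simp: smult_assoc1[symmetric] intro: ideal_smult.smult ideal_prod.prod)
next
  case (sum x y)
  then show ?case
    using c ideal.Icarr[OF I] submodule_in_carrier[OF submodule_ideal_smult[OF K]]
    by (auto simp: smult_r_distr intro: ideal_smult.sum)
qed

text \<open>The identity (IK)M = I(KM), put as an induction rule: the right operand of
  \<open>ideal_smult\<close> is a whole module, so I(KM) is not directly expressible.\<close>

lemma ideal_smult_prod_induct [consumes 3, case_names smult add]:
  assumes I: "ideal I R" and K: "ideal K R" and x: "x \<in> (I \<cdot>\<^bsub>R\<^esub> K) \<star> M"
    and smult: "\<And>c y. \<lbrakk>c \<in> I; y \<in> K \<star> M\<rbrakk> \<Longrightarrow> P (c \<odot>\<^bsub>M\<^esub> y)"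
    and add: "\<And>x y. \<lbrakk>x \<in> carrier M; y \<in> carrier M; P x; P y\<rbrakk> \<Longrightarrow> P (x \<oplus>\<^bsub>M\<^esub> y)"
  shows "P x"
proof -
  have "P x \<and> x \<in> carrier M"
    using x
  proof induction
    case (smult c x)
    from smult(1) have "P (c \<odot>\<^bsub>M\<^esub> x) \<and> c \<in> carrier R"
    proof induction
      case (prod i j)
      then show ?case
        using smult(2) assms(4)[of i "j \<odot>\<^bsub>M\<^esub> x"] ideal.Icarr[OF I] ideal.Icarr[OF K]
        by (auto simp: smult_assoc1 intro: ideal_smult.smult)
    next
      case (sum c d)
      then show ?case
        using smult(2) add by (auto simp: smult_l_distr)
    qed
    then show ?case
      using smult(2) by auto
  next
    case (sum x y)
    then show ?case
      using add by auto
  qed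
  then show ?thesis ..
qed

text \<open>Since b generates a principal ideal, its coefficients can be gathered in a single vector
  \<open>z\<close>. Keeping b as an explicit factor is what allows it to be cancelled later.\<close>

lemma ideal_smult_prod_split:
  assumes I: "ideal I R" and K: "ideal K R" and b: "b \<in> carrier R"
    and x: "x \<in> ((I <+>\<^bsub>R\<^esub> PIdl\<^bsub>R\<^esub> b) \<cdot>\<^bsub>R\<^esub> K) \<star> M"
  shows "\<exists>y \<in> (I \<cdot>\<^bsub>R\<^esub> K) \<star> M. \<exists>z \<in> K \<star> M. x = y \<oplus>\<^bsub>M\<^esub> b \<odot>\<^bsub>M\<^esub> z"
proof -
  have L: "ideal (I <+>\<^bsub>R\<^esub> PIdl\<^bsub>R\<^esub> b) R"
    by (rule R.add_ideals[OF I R.cgenideal_ideal[OF b]])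
  have KM: "submodule (K \<star> M) R M"
    by (rule submodule_ideal_smult[OF K])
  have IKM: "submodule ((I \<cdot>\<^bsub>R\<^esub> K) \<star> M) R M"
    by (rule submodule_ideal_smult[OF R.ideal_prod_is_ideal[OF I K]])
  show ?thesis
    using L K x
  proof (induction rule: ideal_smult_prod_induct)
    case (smult c y)
    then obtain d e where de: "d \<in> I" "e \<in> carrier R" "c = d \<oplus>\<^bsub>R\<^esub> e \<otimes>\<^bsub>R\<^esub> b"
      by (auto simp: set_add_def' cgenideal_def)
    have "c \<odot>\<^bsub>M\<^esub> y = d \<odot>\<^bsub>M\<^esub> y \<oplus>\<^bsub>M\<^esub> b \<odot>\<^bsub>M\<^esub> (e \<odot>\<^bsub>M\<^esub> y)"
      using de b smult(2) ideal.Icarr[OF I] submodule_in_carrier[OF KM]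
      by (simp add: smult_l_distr R.m_comm[of e b] smult_assoc1)
    moreover have "d \<odot>\<^bsub>M\<^esub> y \<in> (I \<cdot>\<^bsub>R\<^esub> K) \<star> M" "e \<odot>\<^bsub>M\<^esub> y \<in> K \<star> M"
      using de smult(2) ideal_smult_prod[OF I K] submoduleE(4)[OF KM] by auto
    ultimately show ?case by blast
  next
    case (add x x')
    then obtain y z y' z' where *: "y \<in> (I \<cdot>\<^bsub>R\<^esub> K) \<star> M" "z \<in> K \<star> M" "x = y \<oplus>\<^bsub>M\<^esub> b \<odot>\<^bsub>M\<^esub> z"
      "y' \<in> (I \<cdot>\<^bsub>R\<^esub> K) \<star> M" "z' \<in> K \<star> M" "x' = y' \<oplus>\<^bsub>M\<^esub> b \<odot>\<^bsub>M\<^esub> z'"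
      by blast
    moreover from this
    have "x \<oplus>\<^bsub>M\<^esub> x' = (y \<oplus>\<^bsub>M\<^esub> y') \<oplus>\<^bsub>M\<^esub> b \<odot>\<^bsub>M\<^esub> (z \<oplus>\<^bsub>M\<^esub> z')"
      by (simp add: add_add_swap smult_r_distr b submodule_in_carrier[OF KM] submodule_in_carrier[OF IKM])
    ultimately show ?case
      by (blast intro: ideal_smult.sum)
  qed
qed

end

section \<open>Quotient modules\<close>

context module
begin

lemma additive_coset_self:
  assumes "submodule N R M" "x \<in> carrier M"
  shows "x \<in> N +>\<^bsub>M\<^esub> x"
  using submodule_zero[OF assms(1)] assms(2) by (force simp: a_r_coset_def')

lemma additive_coset_absorb:
  assumes N: "submodule N R M" and x: "x \<in> carrier M" and y: "y \<in> N"
  shows "N +>\<^bsub>M\<^esub> (y \<oplus>\<^bsub>M\<^esub> x) = N +>\<^bsub>M\<^esub> x"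
proof -
  have "y \<oplus>\<^bsub>M\<^esub> x \<in> N +>\<^bsub>M\<^esub> x"
    using y by (auto simp: a_r_coset_def')
  then show ?thesis
    using M.a_repr_independence'[of "y \<oplus>\<^bsub>M\<^esub> x" N x] x submodule.axioms(1)[OF N]
    by (simp add: a_r_coset_def)
qed

lemma additive_coset_eq_self_iff:
  assumes N: "submodule N R M" and x: "x \<in> carrier M"
  shows "N +>\<^bsub>M\<^esub> x = N \<longleftrightarrow> x \<in> N"
proof
  show "x \<in> N" if "N +>\<^bsub>M\<^esub> x = N"
    using additive_coset_self[OF N x] that by simp
  show "N +>\<^bsub>M\<^esub> x = N" if "x \<in> N"
    using additive_coset_absorb[OF N M.zero_closed that] x M.a_coset_add_zero[of N]
      submoduleE(1)[OF N] by simp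
qed

lemma carrier_quotient_module: "carrier (quotient_module M N) = (\<lambda>x. N +>\<^bsub>M\<^esub> x) ` carrier M"
  by (auto simp: quotient_module_def A_RCOSETS_def')

text \<open>Both directions amount to I(M/QM) = (QM + IM)/QM; in this way the conditions on M/QM in
  (i) become conditions on M.\<close>

lemma coset_in_ideal_smult_quotient_iff:
  assumes Q: "ideal Q R" and I: "ideal I R" and x: "x \<in> carrier M"
  shows "(Q \<star> M) +>\<^bsub>M\<^esub> x \<in> I \<star> quotient_module M (Q \<star> M) \<longleftrightarrow> x \<in> (Q <+>\<^bsub>R\<^esub> I) \<star> M"
proof
  let ?N = "Q \<star> M"
  note N = submodule_ideal_smult[OF Q]
  note IM = submodule_in_carrier[OF submodule_ideal_smult[OF I]]
  \<comment> \<open>The induction runs over an arbitrary coset \<open>Y\<close> and yields only some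
    representative in IM; the given x differs from it by an element of QM.\<close>
  have "\<exists>z \<in> I \<star> M. Y = ?N +>\<^bsub>M\<^esub> z" if "Y \<in> I \<star> quotient_module M ?N" for Y
    using that
  proof induction
    case (smult c Y)
    from smult(2) obtain z where z: "z \<in> carrier M" "Y = ?N +>\<^bsub>M\<^esub> z"
      unfolding carrier_quotient_module by blast
    then show ?case
      using quotient_module_smult[OF N ideal.Icarr[OF I smult(1)] z(1)] smult(1)
      by (auto intro: ideal_smult.smult)
  next
    case (sum Y Z)
    then obtain y z where "y \<in> I \<star> M" "z \<in> I \<star> M" "Y = ?N +>\<^bsub>M\<^esub> y" "Z = ?N +>\<^bsub>M\<^esub> z"
      by blast
    then show ?case
      using quotient_module_add[OF N IM IM, of y z] by (auto intro: ideal_smult.sum)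
  qed
  moreover assume "?N +>\<^bsub>M\<^esub> x \<in> I \<star> quotient_module M ?N"
  ultimately obtain z where z: "z \<in> I \<star> M" "?N +>\<^bsub>M\<^esub> x = ?N +>\<^bsub>M\<^esub> z"
    by blast
  then have "x \<in> ?N +>\<^bsub>M\<^esub> z"
    using additive_coset_self[OF N x] by simp
  then show "x \<in> (Q <+>\<^bsub>R\<^esub> I) \<star> M"
    using z(1) by (auto simp: a_r_coset_def' ideal_smult_add_iff[OF Q I])
next
  let ?N = "Q \<star> M"
  note N = submodule_ideal_smult[OF Q]
  note IM = submodule_in_carrier[OF submodule_ideal_smult[OF I]]
  assume "x \<in> (Q <+>\<^bsub>R\<^esub> I) \<star> M"
  then obtain y z where yz: "y \<in> ?N" "z \<in> I \<star> M" "x = y \<oplus>\<^bsub>M\<^esub> z"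
    by (auto simp: ideal_smult_add_iff[OF Q I])
  from yz(2) have "?N +>\<^bsub>M\<^esub> z \<in> I \<star> quotient_module M ?N"
  proof induction
    case (smult c x)
    then show ?case
      using ideal_smult.smult[of c I "?N +>\<^bsub>M\<^esub> x" "quotient_module M ?N"]
      by (simp add: quotient_module_smult[OF N] quotient_module_coset[OF N] ideal.Icarr[OF I])
  next
    case (sum x y)
    then show ?case
      using ideal_smult.sum[of "?N +>\<^bsub>M\<^esub> x" I "quotient_module M ?N" "?N +>\<^bsub>M\<^esub> y"]
      by (simp add: quotient_module_add[OF N] IM)
  qed
  then show "?N +>\<^bsub>M\<^esub> x \<in> I \<star> quotient_module M ?N"
    using additive_coset_absorb[OF N IM yz(1)] yz(2,3) by simp
qed

text \<open>The coset map is onto, so two sets of cosets agree exactly when their preimages do, and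
  \<open>coset_in_ideal_smult_quotient_iff\<close> computes each preimage. The independent ideals
  \<open>I\<close>, \<open>K\<close>, \<open>L\<close> will be q^(n+1), q and q^n.\<close>

lemma quotient_colon_eq_iff:
  assumes Q: "ideal Q R" and I: "ideal I R" and K: "ideal K R" and L: "ideal L R"
    and c: "c \<in> carrier R"
  shows "colon_elem (quotient_module M (Q \<star> M)) (I \<star> quotient_module M (Q \<star> M)) c \<inter>
        K \<star> quotient_module M (Q \<star> M) = L \<star> quotient_module M (Q \<star> M) \<longleftrightarrow>
      colon_elem M ((Q <+>\<^bsub>R\<^esub> I) \<star> M) c \<inter> (Q <+>\<^bsub>R\<^esub> K) \<star> M = (Q <+>\<^bsub>R\<^esub> L) \<star> M"
    (is "?A = ?B \<longleftrightarrow> ?C = ?D")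
proof -
  let ?N = "Q \<star> M" and ?M' = "quotient_module M (Q \<star> M)"
  note N = submodule_ideal_smult[OF Q]
  interpret M': module R ?M'
    by (rule module_quotient_module[OF N])
  have mem: "?N +>\<^bsub>M\<^esub> x \<in> ?A \<longleftrightarrow> x \<in> ?C" "?N +>\<^bsub>M\<^esub> x \<in> ?B \<longleftrightarrow> x \<in> ?D" if "x \<in> carrier M" for x
    using that c coset_in_ideal_smult_quotient_iff[OF Q I, of "c \<odot>\<^bsub>M\<^esub> x"]
      coset_in_ideal_smult_quotient_iff[OF Q K that] coset_in_ideal_smult_quotient_iff[OF Q L that]
    by (simp_all add: colon_elem_def quotient_module_smult[OF N c that] quotient_module_coset[OF N])
  have sub: "?A \<subseteq> carrier ?M'" "?B \<subseteq> carrier ?M'" "?C \<subseteq> carrier M" "?D \<subseteq> carrier M"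
    using M'.submoduleE(1)[OF M'.submodule_ideal_smult[OF L]]
      submoduleE(1)[OF submodule_ideal_smult[OF R.add_ideals[OF Q L]]]
    by (auto simp: colon_elem_def)
  have "?A = ?B \<longleftrightarrow> (\<forall>Y\<in>carrier ?M'. Y \<in> ?A \<longleftrightarrow> Y \<in> ?B)"
    using sub(1,2) by blast
  also have "\<dots> \<longleftrightarrow> (\<forall>x\<in>carrier M. ?N +>\<^bsub>M\<^esub> x \<in> ?A \<longleftrightarrow> ?N +>\<^bsub>M\<^esub> x \<in> ?B)"
    by (simp only: carrier_quotient_module ball_simps)
  also have "\<dots> \<longleftrightarrow> (\<forall>x\<in>carrier M. x \<in> ?C \<longleftrightarrow> x \<in> ?D)"
    using mem by simp
  also have "\<dots> \<longleftrightarrow> ?C = ?D"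
    using sub(3,4) by blast
  finally show ?thesis .
qed

lemma Ass_quotient_iff:
  assumes N: "submodule N R M"
  shows "p \<in> Ass R (quotient_module M N) \<longleftrightarrow>
    primeideal p R \<and> (\<exists>x\<in>carrier M. p = {c \<in> carrier R. c \<odot>\<^bsub>M\<^esub> x \<in> N})"
proof -
  have zero: "\<zero>\<^bsub>quotient_module M N\<^esub> = N"
    by (simp add: quotient_module_def)
  have ann: "{c \<in> carrier R. c \<odot>\<^bsub>quotient_module M N\<^esub> (N +>\<^bsub>M\<^esub> x) = N} =
      {c \<in> carrier R. c \<odot>\<^bsub>M\<^esub> x \<in> N}" if x: "x \<in> carrier M" for x
  proof (rule Collect_cong, rule conj_cong[OF refl])
    fix c assume c: "c \<in> carrier R"
    show "c \<odot>\<^bsub>quotient_module M N\<^esub> (N +>\<^bsub>M\<^esub> x) = N \<longleftrightarrow> c \<odot>\<^bsub>M\<^esub> x \<in> N"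
      unfolding quotient_module_smult[OF N c x]
      by (rule additive_coset_eq_self_iff[OF N smult_closed[OF c x]])
  qed
  have "(\<exists>Y\<in>carrier (quotient_module M N). p =
        {c \<in> carrier R. c \<odot>\<^bsub>quotient_module M N\<^esub> Y = N}) \<longleftrightarrow>
      (\<exists>x\<in>carrier M. p = {c \<in> carrier R. c \<odot>\<^bsub>quotient_module M N\<^esub> (N +>\<^bsub>M\<^esub> x) = N})"
    by (simp only: carrier_quotient_module bex_simps)
  also have "\<dots> \<longleftrightarrow> (\<exists>x\<in>carrier M. p = {c \<in> carrier R. c \<odot>\<^bsub>M\<^esub> x \<in> N})"
    by (rule bex_cong[OF refl]) (simp only: ann)
  finally show ?thesis
    by (simp only: Ass_def zero mem_Collect_eq)
qed

end

section \<open>Powers of sums of ideals\<close>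

context module
begin

lemma submodule_set_add:
  assumes N: "submodule N R M" and P: "submodule P R M"
  shows "submodule (N <+>\<^bsub>M\<^esub> P) R M"
proof (rule submoduleI)
  note N_in = submodule_in_carrier[OF N] and P_in = submodule_in_carrier[OF P]
  show "N <+>\<^bsub>M\<^esub> P \<subseteq> carrier M"
    by (auto simp: set_add_def' N_in P_in)
  have "\<zero>\<^bsub>M\<^esub> = \<zero>\<^bsub>M\<^esub> \<oplus>\<^bsub>M\<^esub> \<zero>\<^bsub>M\<^esub>"
    by simp
  then show "\<zero>\<^bsub>M\<^esub> \<in> N <+>\<^bsub>M\<^esub> P"
    unfolding set_add_def' using submodule_zero[OF N] submodule_zero[OF P] by blast
  fix x assume "x \<in> N <+>\<^bsub>M\<^esub> P"
  then obtain y z where yz: "y \<in> N" "z \<in> P" "x = y \<oplus>\<^bsub>M\<^esub> z"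
    by (auto simp: set_add_def')
  have "\<ominus>\<^bsub>M\<^esub> x = \<ominus>\<^bsub>M\<^esub> y \<oplus>\<^bsub>M\<^esub> \<ominus>\<^bsub>M\<^esub> z"
    using yz N_in P_in by (simp add: M.minus_add)
  then show "\<ominus>\<^bsub>M\<^esub> x \<in> N <+>\<^bsub>M\<^esub> P"
    unfolding set_add_def' using submoduleE(3)[OF N yz(1)] submoduleE(3)[OF P yz(2)] by blast
  show "c \<odot>\<^bsub>M\<^esub> x \<in> N <+>\<^bsub>M\<^esub> P" if c: "c \<in> carrier R" for c
  proof -
    have "c \<odot>\<^bsub>M\<^esub> x = c \<odot>\<^bsub>M\<^esub> y \<oplus>\<^bsub>M\<^esub> c \<odot>\<^bsub>M\<^esub> z"
      using c yz N_in P_in by (simp add: smult_r_distr)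
    then show ?thesis
      unfolding set_add_def' using submoduleE(4)[OF N c yz(1)] submoduleE(4)[OF P c yz(2)] by blast
  qed
  fix x' assume "x' \<in> N <+>\<^bsub>M\<^esub> P"
  then obtain y' z' where yz': "y' \<in> N" "z' \<in> P" "x' = y' \<oplus>\<^bsub>M\<^esub> z'"
    by (auto simp: set_add_def')
  have "x \<oplus>\<^bsub>M\<^esub> x' = (y \<oplus>\<^bsub>M\<^esub> y') \<oplus>\<^bsub>M\<^esub> (z \<oplus>\<^bsub>M\<^esub> z')"
    using yz yz' N_in P_in by (simp add: add_add_swap)
  then show "x \<oplus>\<^bsub>M\<^esub> x' \<in> N <+>\<^bsub>M\<^esub> P"
    unfolding set_add_def'
    using submoduleE(5)[OF N yz(1) yz'(1)] submoduleE(5)[OF P yz(2) yz'(2)] by blast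
qed

lemma submodule_smult_image:
  assumes N: "submodule N R M" and b: "b \<in> carrier R"
  shows "submodule ((\<lambda>x. b \<odot>\<^bsub>M\<^esub> x) ` N) R M"
proof (rule submoduleI)
  note N_in = submodule_in_carrier[OF N]
  show "(\<lambda>x. b \<odot>\<^bsub>M\<^esub> x) ` N \<subseteq> carrier M"
    using N_in b by blast
  show "\<zero>\<^bsub>M\<^esub> \<in> (\<lambda>x. b \<odot>\<^bsub>M\<^esub> x) ` N"
    by (rule image_eqI[OF _ submodule_zero[OF N]]) (use b in simp)
  fix x assume "x \<in> (\<lambda>x. b \<odot>\<^bsub>M\<^esub> x) ` N"
  then obtain y where y: "x = b \<odot>\<^bsub>M\<^esub> y" "y \<in> N"
    by blast
  show "\<ominus>\<^bsub>M\<^esub> x \<in> (\<lambda>x. b \<odot>\<^bsub>M\<^esub> x) ` N"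
    by (rule image_eqI[OF _ submoduleE(3)[OF N y(2)]])
      (simp add: y(1) b N_in[OF y(2)] smult_r_minus)
  show "c \<odot>\<^bsub>M\<^esub> x \<in> (\<lambda>x. b \<odot>\<^bsub>M\<^esub> x) ` N" if c: "c \<in> carrier R" for c
    by (rule image_eqI[OF _ submoduleE(4)[OF N c y(2)]])
      (simp add: y(1) smult_commute[OF c b N_in[OF y(2)]])
  fix x' assume "x' \<in> (\<lambda>x. b \<odot>\<^bsub>M\<^esub> x) ` N"
  then obtain y' where y': "x' = b \<odot>\<^bsub>M\<^esub> y'" "y' \<in> N"
    by blast
  show "x \<oplus>\<^bsub>M\<^esub> x' \<in> (\<lambda>x. b \<odot>\<^bsub>M\<^esub> x) ` N"
    by (rule image_eqI[OF _ submoduleE(5)[OF N y(2) y'(2)]])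
      (simp add: y(1) y'(1) b N_in[OF y(2)] N_in[OF y'(2)] smult_r_distr)
qed

lemma submodule_ideal_image:
  assumes I: "ideal I R" and x: "x \<in> carrier M"
  shows "submodule ((\<lambda>c. c \<odot>\<^bsub>M\<^esub> x) ` I) R M"
proof (rule submoduleI)
  interpret I: ideal I R by fact
  note I_in = ideal.Icarr[OF I]
  show "(\<lambda>c. c \<odot>\<^bsub>M\<^esub> x) ` I \<subseteq> carrier M"
    using I_in x by blast
  show "\<zero>\<^bsub>M\<^esub> \<in> (\<lambda>c. c \<odot>\<^bsub>M\<^esub> x) ` I"
    by (rule image_eqI[OF _ I.zero_closed]) (use x in simp)
  fix y assume "y \<in> (\<lambda>c. c \<odot>\<^bsub>M\<^esub> x) ` I"
  then obtain c where c: "y = c \<odot>\<^bsub>M\<^esub> x" "c \<in> I"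
    by blast
  show "\<ominus>\<^bsub>M\<^esub> y \<in> (\<lambda>c. c \<odot>\<^bsub>M\<^esub> x) ` I"
    by (rule image_eqI[OF _ I.a_inv_closed[OF c(2)]])
      (simp add: c(1) x I_in[OF c(2)] smult_l_minus)
  show "d \<odot>\<^bsub>M\<^esub> y \<in> (\<lambda>c. c \<odot>\<^bsub>M\<^esub> x) ` I" if d: "d \<in> carrier R" for d
    by (rule image_eqI[OF _ I.I_l_closed[OF c(2) d]])
      (simp add: c(1) x d I_in[OF c(2)] smult_assoc1)
  fix y' assume "y' \<in> (\<lambda>c. c \<odot>\<^bsub>M\<^esub> x) ` I"
  then obtain c' where c': "y' = c' \<odot>\<^bsub>M\<^esub> x" "c' \<in> I"
    by blast
  show "y \<oplus>\<^bsub>M\<^esub> y' \<in> (\<lambda>c. c \<odot>\<^bsub>M\<^esub> x) ` I"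
    by (rule image_eqI[OF _ I.a_closed[OF c(2) c'(2)]])
      (simp add: c(1) c'(1) x I_in[OF c(2)] I_in[OF c'(2)] smult_l_distr)
qed

lemma ideal_smult_prod_subset:
  assumes I: "ideal I R" and K: "ideal K R" and N: "submodule N R M"
    and gen: "\<And>c y. \<lbrakk>c \<in> I; y \<in> K \<star> M\<rbrakk> \<Longrightarrow> c \<odot>\<^bsub>M\<^esub> y \<in> N"
  shows "(I \<cdot>\<^bsub>R\<^esub> K) \<star> M \<subseteq> N"
proof
  fix x assume "x \<in> (I \<cdot>\<^bsub>R\<^esub> K) \<star> M"
  with I K show "x \<in> N"
    by (induction rule: ideal_smult_prod_induct) (use gen submoduleE(5)[OF N] in auto)
qed

text \<open>When the power is expanded, every product with a factor in \<open>I\<close> lies in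
  \<open>I\<close>, and only the pure power of \<open>K\<close> is left.\<close>

lemma sum_power_ideal_smult_subset:
  assumes I: "ideal I R" and K: "ideal K R"
  shows "((I <+>\<^bsub>R\<^esub> K) [^]\<^bsub>ideals_set R\<^esub> (n::nat)) \<star> M \<subseteq> (I <+>\<^bsub>R\<^esub> (K [^]\<^bsub>ideals_set R\<^esub> n)) \<star> M"
proof (induction n)
  case 0
  have "x \<in> (I <+>\<^bsub>R\<^esub> carrier R) \<star> M" if "x \<in> carrier R \<star> M" for x
    using that ideal_smult_add_iff[OF I R.oneideal] submodule_zero[OF submodule_ideal_smult[OF I]]
    by (metis M.l_zero carrier_ideal_smult)
  then show ?case
    by auto
next
  case (Suc n)
  let ?L = "I <+>\<^bsub>R\<^esub> K"
  have L: "ideal ?L R" "ideal (?L [^]\<^bsub>ideals_set R\<^esub> n) R"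
    using R.add_ideals[OF I K] by (simp_all add: R.ideal_power_is_ideal)
  have Kn: "ideal (K [^]\<^bsub>ideals_set R\<^esub> n) R" "ideal (K [^]\<^bsub>ideals_set R\<^esub> Suc n) R"
    by (simp_all only: R.ideal_power_is_ideal[OF K])
  have IM: "submodule (I \<star> M) R M"
    by (rule submodule_ideal_smult[OF I])
  show ?case
    unfolding R.ideal_power_Suc_left[OF L(1)]
  proof (rule ideal_smult_prod_subset[OF L])
    show "submodule ((I <+>\<^bsub>R\<^esub> (K [^]\<^bsub>ideals_set R\<^esub> Suc n)) \<star> M) R M"
      by (rule submodule_ideal_smult[OF R.add_ideals[OF I Kn(2)]])
    fix c w assume "c \<in> ?L" and w: "w \<in> (?L [^]\<^bsub>ideals_set R\<^esub> n) \<star> M"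
    then obtain d e where de: "d \<in> I" "e \<in> K" "c = d \<oplus>\<^bsub>R\<^esub> e"
      by (auto simp: set_add_def')
    obtain y z where yz: "y \<in> I \<star> M" "z \<in> (K [^]\<^bsub>ideals_set R\<^esub> n) \<star> M" "w = y \<oplus>\<^bsub>M\<^esub> z"
      using Suc w ideal_smult_add_iff[OF I Kn(1)] by blast
    note in_carrier = ideal.Icarr[OF I de(1)] ideal.Icarr[OF K de(2)]
      submodule_in_carrier[OF IM yz(1)]
      submodule_in_carrier[OF submodule_ideal_smult[OF Kn(1)] yz(2)]
    \<comment> \<open>With c = d + e and w = y + z, the product cw sorts into dw + ey, a member of
      IM, and ez.\<close>
    have "d \<odot>\<^bsub>M\<^esub> w \<oplus>\<^bsub>M\<^esub> e \<odot>\<^bsub>M\<^esub> y \<in> I \<star> M"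
      using de(1) in_carrier yz(1,3) submoduleE(4,5)[OF IM] by (simp add: ideal_smult.smult)
    moreover have "e \<odot>\<^bsub>M\<^esub> z \<in> (K [^]\<^bsub>ideals_set R\<^esub> Suc n) \<star> M"
      unfolding R.ideal_power_Suc_left[OF K] by (rule ideal_smult_prod[OF K Kn(1) de(2) yz(2)])
    moreover have "c \<odot>\<^bsub>M\<^esub> w = (d \<odot>\<^bsub>M\<^esub> w \<oplus>\<^bsub>M\<^esub> e \<odot>\<^bsub>M\<^esub> y) \<oplus>\<^bsub>M\<^esub> e \<odot>\<^bsub>M\<^esub> z"
      using in_carrier by (simp add: de(3) yz(3) smult_l_distr smult_r_distr M.a_ac)
    ultimately show "c \<odot>\<^bsub>M\<^esub> w \<in> (I <+>\<^bsub>R\<^esub> (K [^]\<^bsub>ideals_set R\<^esub> Suc n)) \<star> M"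
      using ideal_smult_add_iff[OF I Kn(2)] by blast
  qed
qed

text \<open>In a product of n+1 factors, each from \<open>I\<close> or a multiple of b, either b
  never occurs or one factor b can be pulled out. Pulling it out just once leaves \<open>u\<close>
  in the full L^n M and avoids a binomial expansion.\<close>

lemma ideal_power_smult_split:
  assumes I: "ideal I R" and b: "b \<in> carrier R" and L: "L = I <+>\<^bsub>R\<^esub> PIdl\<^bsub>R\<^esub> b"
    and z: "z \<in> (L [^]\<^bsub>ideals_set R\<^esub> Suc n) \<star> M"
  shows "\<exists>v \<in> (I [^]\<^bsub>ideals_set R\<^esub> Suc n) \<star> M. \<exists>u \<in> (L [^]\<^bsub>ideals_set R\<^esub> n) \<star> M. z = v \<oplus>\<^bsub>M\<^esub> b \<odot>\<^bsub>M\<^esub> u"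
proof -
  have idL: "ideal L R"
    unfolding L by (rule R.add_ideals[OF I R.cgenideal_ideal[OF b]])
  have pow: "ideal (I [^]\<^bsub>ideals_set R\<^esub> k) R" "ideal (L [^]\<^bsub>ideals_set R\<^esub> k) R" for k :: nat
    using R.ideal_power_is_ideal I idL by blast+
  \<comment> \<open>The right side of the claim, made into a submodule so that
    \<open>ideal_smult_prod_subset\<close> reduces the induction step to single products.\<close>
  define D where "D k = (I [^]\<^bsub>ideals_set R\<^esub> Suc k) \<star> M <+>\<^bsub>M\<^esub>
    (\<lambda>u. b \<odot>\<^bsub>M\<^esub> u) ` ((L [^]\<^bsub>ideals_set R\<^esub> k) \<star> M)" for k :: nat
  have D: "submodule (D k) R M" for k
    unfolding D_def by (intro submodule_set_add submodule_smult_image submodule_ideal_smult pow b)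
  have D_iff: "x \<in> D k \<longleftrightarrow> (\<exists>v \<in> (I [^]\<^bsub>ideals_set R\<^esub> Suc k) \<star> M.
      \<exists>u \<in> (L [^]\<^bsub>ideals_set R\<^esub> k) \<star> M. x = v \<oplus>\<^bsub>M\<^esub> b \<odot>\<^bsub>M\<^esub> u)" for k x
    unfolding D_def set_add_def' by blast
  have "(L [^]\<^bsub>ideals_set R\<^esub> Suc k) \<star> M \<subseteq> D k" for k
  proof (induction k)
    case 0
    have "I [^]\<^bsub>ideals_set R\<^esub> Suc 0 = I \<cdot>\<^bsub>R\<^esub> carrier R"
      using R.ideal_power_Suc_left[OF I, of 0] by simp
    then show ?case
      using ideal_smult_prod_split[OF I R.oneideal b, folded L] R.ideal_power_Suc_left[OF idL, of 0]
      by (auto simp: D_iff simp del: nat_pow_Suc)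
  next
    case (Suc k)
    have "x \<in> D (Suc k)" if x: "x \<in> (L [^]\<^bsub>ideals_set R\<^esub> Suc (Suc k)) \<star> M" for x
    proof -
      obtain y u where yu: "y \<in> (I \<cdot>\<^bsub>R\<^esub> (L [^]\<^bsub>ideals_set R\<^esub> Suc k)) \<star> M"
        "u \<in> (L [^]\<^bsub>ideals_set R\<^esub> Suc k) \<star> M" "x = y \<oplus>\<^bsub>M\<^esub> b \<odot>\<^bsub>M\<^esub> u"
        using ideal_smult_prod_split[OF I pow(2) b, of x "Suc k"] x
        unfolding R.ideal_power_Suc_left[OF idL, of "Suc k"] L[symmetric] by blast
      \<comment> \<open>The part in I L^(k+1) M is expanded once more by the induction hypothesis:
        c(v + bt) = cv + b(ct), where ct lies in L^(k+1) M because \<open>I\<close> is contained in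
        \<open>L\<close>.\<close>
      have "(I \<cdot>\<^bsub>R\<^esub> (L [^]\<^bsub>ideals_set R\<^esub> Suc k)) \<star> M \<subseteq> D (Suc k)"
      proof (rule ideal_smult_prod_subset[OF I pow(2) D])
        fix c w assume c: "c \<in> I" and "w \<in> (L [^]\<^bsub>ideals_set R\<^esub> Suc k) \<star> M"
        then obtain v t where vt: "v \<in> (I [^]\<^bsub>ideals_set R\<^esub> Suc k) \<star> M"
          "t \<in> (L [^]\<^bsub>ideals_set R\<^esub> k) \<star> M" "w = v \<oplus>\<^bsub>M\<^esub> b \<odot>\<^bsub>M\<^esub> t"
          using Suc D_iff by blast
        note in_carrier = ideal.Icarr[OF I c]
          submodule_in_carrier[OF submodule_ideal_smult[OF pow(1)] vt(1)]
          submodule_in_carrier[OF submodule_ideal_smult[OF pow(2)] vt(2)]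
        have "I \<subseteq> L"
        proof
          fix d assume d: "d \<in> I"
          have "\<zero>\<^bsub>R\<^esub> \<in> PIdl\<^bsub>R\<^esub> b"
            using R.cgenideal_ideal[OF b] by (simp add: ideal_def additive_subgroup.zero_closed)
          moreover have "d = d \<oplus>\<^bsub>R\<^esub> \<zero>\<^bsub>R\<^esub>"
            using ideal.Icarr[OF I d] by simp
          ultimately show "d \<in> L"
            unfolding L set_add_def' using d by blast
        qed
        then have "c \<odot>\<^bsub>M\<^esub> t \<in> (L [^]\<^bsub>ideals_set R\<^esub> Suc k) \<star> M"
          unfolding R.ideal_power_Suc_left[OF idL]
          using c by (intro ideal_smult_prod[OF idL pow(2) _ vt(2)]) blast
        moreover have "c \<odot>\<^bsub>M\<^esub> v \<in> (I [^]\<^bsub>ideals_set R\<^esub> Suc (Suc k)) \<star> M"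
          unfolding R.ideal_power_Suc_left[OF I, of "Suc k"]
          by (rule ideal_smult_prod[OF I pow(1) c vt(1)])
        moreover have "c \<odot>\<^bsub>M\<^esub> w = c \<odot>\<^bsub>M\<^esub> v \<oplus>\<^bsub>M\<^esub> b \<odot>\<^bsub>M\<^esub> (c \<odot>\<^bsub>M\<^esub> t)"
          using in_carrier b by (simp add: vt(3) smult_r_distr smult_commute)
        ultimately show "c \<odot>\<^bsub>M\<^esub> w \<in> D (Suc k)"
          unfolding D_iff by blast
      qed
      then have "y \<in> D (Suc k)"
        using yu(1) by blast
      moreover have "b \<odot>\<^bsub>M\<^esub> u \<in> D (Suc k)"
      proof -
        have "b \<odot>\<^bsub>M\<^esub> u = \<zero>\<^bsub>M\<^esub> \<oplus>\<^bsub>M\<^esub> b \<odot>\<^bsub>M\<^esub> u"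
          using b submodule_in_carrier[OF submodule_ideal_smult[OF pow(2)] yu(2)] by simp
        then show ?thesis
          unfolding D_iff using yu(2) submodule_zero[OF submodule_ideal_smult[OF pow(1)]] by blast
      qed
      ultimately show ?thesis
        unfolding yu(3) by (rule submoduleE(5)[OF D])
    qed
    then show ?case ..
  qed
  then show ?thesis
    using z D_iff by blast
qed

end

section \<open>Relatively regular sequences\<close>

locale sequence_in_ring = module R M for R (structure) and M (structure) +
  fixes a :: "nat \<Rightarrow> 'a" and r :: nat
  assumes seq_closed: "i \<in> {1..r} \<Longrightarrow> a i \<in> carrier R"
begin

section \<open>Ideals generated by initial and final segments of the sequence\<close>

definition Q :: "nat \<Rightarrow> 'a set" where "Q j = Idl\<^bsub>R\<^esub> (a ` {1..j})"

text \<open>The index is shifted so that \<open>T j\<close> complements \<open>Q j\<close>: the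
  ideal (a_i, ..., a_r) of (iii) is \<open>T (i - 1)\<close>, and \<open>T r\<close> is zero, which
  starts the descending induction.\<close>

definition T :: "nat \<Rightarrow> 'a set" where "T j = Idl\<^bsub>R\<^esub> (a ` {Suc j..r})"

abbreviation N :: "nat \<Rightarrow> 'c set" where "N j \<equiv> Q j \<star> M"

lemma seq_image_closed: "S \<subseteq> {1..r} \<Longrightarrow> a ` S \<subseteq> carrier R"
  using seq_closed by blast

lemma Q_ideal: "j \<le> r \<Longrightarrow> ideal (Q j) R"
  unfolding Q_def by (rule R.genideal_ideal[OF seq_image_closed]) auto

lemma T_ideal: "ideal (T j) R"
  unfolding T_def by (rule R.genideal_ideal[OF seq_image_closed]) auto

lemma N_submodule: "j \<le> r \<Longrightarrow> submodule (N j) R M"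
  by (rule submodule_ideal_smult[OF Q_ideal])

lemma generator_in_Q:
  assumes "i \<in> {1..j}" "j \<le> r"
  shows "a i \<in> Q j"
  unfolding Q_def using R.genideal_self[OF seq_image_closed, of "{1..j}"] assms by fastforce

lemma generator_in_T: "j < r \<Longrightarrow> a (Suc j) \<in> T j"
  unfolding T_def using R.genideal_self[OF seq_image_closed, of "{Suc j..r}"] by fastforce

lemma Q_mono:
  assumes "i \<le> j" "j \<le> r"
  shows "Q i \<subseteq> Q j"
proof -
  have "a ` {1..i} \<subseteq> Q j"
    using generator_in_Q assms by auto
  then show ?thesis
    unfolding Q_def[of i] by (rule R.genideal_minimal[OF Q_ideal[OF assms(2)]])
qed

lemma T_subset_Q: "T j \<subseteq> Q r"
proof -
  have "a ` {Suc j..r} \<subseteq> Q r"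
    using generator_in_Q by auto
  then show ?thesis
    unfolding T_def by (rule R.genideal_minimal[OF Q_ideal[OF order_refl]])
qed

lemma Q_Suc:
  assumes "j < r"
  shows "Q (Suc j) = Q j <+>\<^bsub>R\<^esub> PIdl\<^bsub>R\<^esub> a (Suc j)"
proof -
  have "a ` {1..Suc j} = a ` {1..j} \<union> {a (Suc j)}"
    by (auto simp: atLeastAtMostSuc_conv)
  moreover have "Idl\<^bsub>R\<^esub> (a ` {1..j} \<union> {a (Suc j)}) = Idl\<^bsub>R\<^esub> (a ` {1..j}) <+>\<^bsub>R\<^esub> Idl\<^bsub>R\<^esub> {a (Suc j)}"
    by (rule R.genideal_Un[OF seq_image_closed]) (use assms seq_closed in auto)
  ultimately show ?thesis
    unfolding Q_def using assms seq_closed[of "Suc j"] by (simp add: R.cgenideal_eq_genideal)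
qed

lemma T_Suc:
  assumes "j < r"
  shows "T j = T (Suc j) <+>\<^bsub>R\<^esub> PIdl\<^bsub>R\<^esub> a (Suc j)"
proof -
  have "{Suc j..r} = {Suc (Suc j)..r} \<union> {Suc j}"
    using assms by auto
  then have "a ` {Suc j..r} = a ` {Suc (Suc j)..r} \<union> {a (Suc j)}"
    by simp
  moreover have "Idl\<^bsub>R\<^esub> (a ` {Suc (Suc j)..r} \<union> {a (Suc j)}) =
      Idl\<^bsub>R\<^esub> (a ` {Suc (Suc j)..r}) <+>\<^bsub>R\<^esub> Idl\<^bsub>R\<^esub> {a (Suc j)}"
    by (rule R.genideal_Un[OF seq_image_closed]) (use assms seq_closed in auto)
  ultimately show ?thesis
    unfolding T_def using assms seq_closed[of "Suc j"] by (simp add: R.cgenideal_eq_genideal)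
qed

lemma T_antimono: "T (Suc j) \<subseteq> T j"
proof -
  have "a ` {Suc (Suc j)..r} \<subseteq> T j"
    unfolding T_def using R.genideal_self[OF seq_image_closed, of "{Suc j..r}"] by fastforce
  then show ?thesis
    unfolding T_def[of "Suc j"] by (rule R.genideal_minimal[OF T_ideal])
qed

lemma T_end: "T r = {\<zero>\<^bsub>R\<^esub>}"
  by (simp add: T_def R.genideal_empty)

lemma Q_T_split:
  assumes "j \<le> r"
  shows "Q r = Q j <+>\<^bsub>R\<^esub> T j"
proof -
  have "{1..r} = {1..j} \<union> {Suc j..r}"
    using assms by auto
  then have "a ` {1..r} = a ` {1..j} \<union> a ` {Suc j..r}"
    by (simp add: image_Un)
  then show ?thesis
    unfolding Q_def T_def using assms seq_image_closed[of "{1..j}"] seq_image_closed[of "{Suc j..r}"]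
    by (auto simp: R.genideal_Un)
qed

lemma N_mono: "\<lbrakk>i \<le> j; j \<le> r\<rbrakk> \<Longrightarrow> N i \<subseteq> N j"
  by (rule ideal_smult_mono[OF Q_mono])

lemma N_Suc_split:
  assumes "j < r" "x \<in> N (Suc j)"
  shows "\<exists>y \<in> N j. \<exists>z \<in> carrier M. x = y \<oplus>\<^bsub>M\<^esub> a (Suc j) \<odot>\<^bsub>M\<^esub> z"
proof -
  \<comment> \<open>Q_(j+1) is read as Q_(j+1) R, so that the splitting of products applies with K =
    R, where KM = M.\<close>
  have "x \<in> ((Q j <+>\<^bsub>R\<^esub> PIdl\<^bsub>R\<^esub> a (Suc j)) \<cdot>\<^bsub>R\<^esub> carrier R) \<star> M"
    using assms Q_ideal[of "Suc j"] by (simp add: R.ideal_prod_one Q_Suc[symmetric])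
  then show ?thesis
    using ideal_smult_prod_split[of "Q j" "carrier R" "a (Suc j)" x] assms(1) Q_ideal[of j]
      seq_closed[of "Suc j"] R.oneideal
    by (simp add: R.ideal_prod_one carrier_ideal_smult)
qed

lemma generator_smult_in_N:
  "\<lbrakk>i \<in> {1..j}; j \<le> r; x \<in> carrier M\<rbrakk> \<Longrightarrow> a i \<odot>\<^bsub>M\<^esub> x \<in> N j"
  by (rule ideal_smult.smult[OF generator_in_Q])

lemma colon_ideal_Q:
  "\<lbrakk>submodule P R M; j \<le> r\<rbrakk> \<Longrightarrow>
    x \<in> colon_ideal M P (Q j) \<longleftrightarrow> x \<in> carrier M \<and> (\<forall>i\<in>{1..j}. a i \<odot>\<^bsub>M\<^esub> x \<in> P)"
  unfolding Q_def using colon_ideal_genideal[OF _ seq_image_closed, of P "{1..j}"]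
  by (simp add: colon_ideal_def)

text \<open>Says that \<open>a (Suc j)\<close> acts injectively on qM / q_jM, with j = i - 1. The
  inclusion of q_(i-1)M in the left side of (iv) always holds, so this implication carries all of
  (iv).\<close>

definition relatively_regular :: bool where
  "relatively_regular \<longleftrightarrow>
    (\<forall>j<r. \<forall>x \<in> N r. a (Suc j) \<odot>\<^bsub>M\<^esub> x \<in> N j \<longrightarrow> x \<in> N j)"

lemma relatively_regularD:
  "\<lbrakk>relatively_regular; j < r; x \<in> N r; a (Suc j) \<odot>\<^bsub>M\<^esub> x \<in> N j\<rbrakk> \<Longrightarrow> x \<in> N j"
  by (simp add: relatively_regular_def)

lemma N_in_carrier: "\<lbrakk>j \<le> r; x \<in> N j\<rbrakk> \<Longrightarrow> x \<in> carrier M"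
  by (rule submodule_in_carrier[OF N_submodule])

lemma relatively_regular_iff_colon:
  "relatively_regular \<longleftrightarrow> (\<forall>j<r. colon_elem M (N j) (a (Suc j)) \<inter> N r = N j)"
proof -
  have "colon_elem M (N j) (a (Suc j)) \<inter> N r = N j \<longleftrightarrow>
      (\<forall>x \<in> N r. a (Suc j) \<odot>\<^bsub>M\<^esub> x \<in> N j \<longrightarrow> x \<in> N j)" if j: "j < r" for j
  proof -
    have "N j \<subseteq> colon_elem M (N j) (a (Suc j)) \<inter> N r"
      using j N_in_carrier[of j] submoduleE(4)[OF N_submodule[of j]] seq_closed[of "Suc j"]
        N_mono[of j r] by (auto simp: colon_elem_def)
    then show ?thesis
      using N_in_carrier[of r] by (auto simp: colon_elem_def)
  qed
  then show ?thesis
    by (simp add: relatively_regular_def)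
qed

lemma T_power_ideal: "ideal (T j [^]\<^bsub>ideals_set R\<^esub> (n::nat)) R"
  by (rule R.ideal_power_is_ideal[OF T_ideal])

text \<open>An exponent of at least 1 places vectors in qM, which is where
  \<open>relatively_regular\<close> permits cancellation.\<close>

lemma T_power_Suc_subset_N: "(T j [^]\<^bsub>ideals_set R\<^esub> Suc n) \<star> M \<subseteq> N r"
  using R.ideal_prod_inter[OF T_ideal T_power_ideal, of j j n] T_subset_Q[of j]
  unfolding R.ideal_power_Suc_left[OF T_ideal] by (intro ideal_smult_mono) blast

text \<open>Let b = a_(j+1). A vector z of T_j^(n+2) M splits as v + bu, where v comes from T_(j+1)
  alone. As z lies in q_jM, v lies in q_(j+1)M, and the outer hypothesis rewrites it as w + bu'.
  Then b(u' + u) lies in q_jM, b cancels because u' + u is in qM, and the inner hypothesis applies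
  to u' + u.\<close>

lemma relatively_regular_Int_power:
  assumes reg: "relatively_regular" and "j \<le> r"
  shows "N j \<inter> (T j [^]\<^bsub>ideals_set R\<^esub> Suc n) \<star> M \<subseteq> (Q j \<cdot>\<^bsub>R\<^esub> (T j [^]\<^bsub>ideals_set R\<^esub> n)) \<star> M"
  using \<open>j \<le> r\<close>
proof (induction j arbitrary: n rule: inc_induct)
  \<comment> \<open>T_r is the zero ideal, so the intersection is zero.\<close>
  case base
  have "(T r [^]\<^bsub>ideals_set R\<^esub> Suc n) \<star> M \<subseteq> {\<zero>\<^bsub>R\<^esub>} \<star> M"
    using R.ideal_prod_inter[OF T_ideal T_power_ideal, of r r n] T_end
    unfolding R.ideal_power_Suc_left[OF T_ideal] by (intro ideal_smult_mono) blast
  then show ?case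
    using zero_ideal_smult
      submodule_zero[OF submodule_ideal_smult[OF R.ideal_prod_is_ideal[OF Q_ideal T_power_ideal]]]
    by blast
next
  case (step j)
  let ?b = "a (Suc j)" and ?T' = "T (Suc j)"
  have j: "j \<le> r" "Suc j \<le> r" "j < r"
    using step by auto
  have b: "?b \<in> carrier R"
    using j by (simp add: seq_closed)
  note N = N_submodule[OF j(1)]
  note QT = R.ideal_prod_is_ideal[OF Q_ideal[OF j(1)] T_power_ideal]
  show ?case
  proof (induction n)
    \<comment> \<open>A zeroth power is the whole ring, so the right side is all of q_jM.\<close>
    case 0
    show ?case
      by (simp add: R.ideal_prod_one Q_ideal j)
  next
    case (Suc n)
    show ?case
    proof
      fix z assume "z \<in> N j \<inter> (T j [^]\<^bsub>ideals_set R\<^esub> Suc (Suc n)) \<star> M"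
      then have z: "z \<in> N j" "z \<in> (T j [^]\<^bsub>ideals_set R\<^esub> Suc (Suc n)) \<star> M"
        by blast+
      obtain v u where vu: "v \<in> (?T' [^]\<^bsub>ideals_set R\<^esub> Suc (Suc n)) \<star> M"
        "u \<in> (T j [^]\<^bsub>ideals_set R\<^esub> Suc n) \<star> M" "z = v \<oplus>\<^bsub>M\<^esub> ?b \<odot>\<^bsub>M\<^esub> u"
        using ideal_power_smult_split[OF T_ideal b T_Suc[OF j(3)] z(2)] by blast
      have u: "u \<in> carrier M" and v: "v \<in> carrier M"
        using vu submodule_in_carrier[OF submodule_ideal_smult[OF T_power_ideal]] by blast+
      have "z \<in> N (Suc j)"
        using z(1) N_mono[of j "Suc j"] j by auto
      then have "v \<in> N (Suc j)"
        using submodule_add_cancel_right[OF N_submodule[OF j(2)] v]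
          generator_smult_in_N[OF _ j(2) u, of "Suc j"] vu(3) by auto
      \<comment> \<open>The outer hypothesis is used at exponent n+1, not n; hence it is kept
        general in \<open>n\<close>.\<close>
      then have "v \<in> (Q (Suc j) \<cdot>\<^bsub>R\<^esub> (?T' [^]\<^bsub>ideals_set R\<^esub> Suc n)) \<star> M"
        using step.IH[of "Suc n"] vu(1) by blast
      then obtain w u' where wu: "w \<in> (Q j \<cdot>\<^bsub>R\<^esub> (?T' [^]\<^bsub>ideals_set R\<^esub> Suc n)) \<star> M"
        "u' \<in> (?T' [^]\<^bsub>ideals_set R\<^esub> Suc n) \<star> M" "v = w \<oplus>\<^bsub>M\<^esub> ?b \<odot>\<^bsub>M\<^esub> u'"
        using ideal_smult_prod_split[OF Q_ideal[OF j(1)] T_power_ideal b] Q_Suc[OF j(3)] by metis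
      have T'_T: "?T' [^]\<^bsub>ideals_set R\<^esub> Suc n \<subseteq> T j [^]\<^bsub>ideals_set R\<^esub> Suc n"
        by (rule R.ideal_power_mono[OF T_antimono])
      have w: "w \<in> (Q j \<cdot>\<^bsub>R\<^esub> (T j [^]\<^bsub>ideals_set R\<^esub> Suc n)) \<star> M"
        using ideal_smult_mono[OF ideal_prod_mono[OF order_refl T'_T]] wu(1) by blast
      have wN: "w \<in> N j"
        using ideal_smult_mono[of "Q j \<cdot>\<^bsub>R\<^esub> (T j [^]\<^bsub>ideals_set R\<^esub> Suc n)" "Q j"] w
          R.ideal_prod_inter[OF Q_ideal[OF j(1)] T_power_ideal] by blast
      have uu': "u' \<oplus>\<^bsub>M\<^esub> u \<in> (T j [^]\<^bsub>ideals_set R\<^esub> Suc n) \<star> M"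
        using ideal_smult_mono[OF T'_T] wu(2) vu(2)
        by (intro submoduleE(5)[OF submodule_ideal_smult[OF T_power_ideal]]) blast+
      note in_carrier = u submodule_in_carrier[OF submodule_ideal_smult[OF T_power_ideal] wu(2)]
        N_in_carrier[OF j(1) wN]
      have z_eq: "z = w \<oplus>\<^bsub>M\<^esub> ?b \<odot>\<^bsub>M\<^esub> (u' \<oplus>\<^bsub>M\<^esub> u)"
        using in_carrier b by (simp add: vu(3) wu(3) smult_r_distr M.a_assoc)
      then have "?b \<odot>\<^bsub>M\<^esub> (u' \<oplus>\<^bsub>M\<^esub> u) \<in> N j"
        using submodule_add_cancel_left[OF N _ wN, of "?b \<odot>\<^bsub>M\<^esub> (u' \<oplus>\<^bsub>M\<^esub> u)"] z(1) b in_carrier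
        by simp
      then have "u' \<oplus>\<^bsub>M\<^esub> u \<in> N j"
        using relatively_regularD[OF reg j(3)] uu' T_power_Suc_subset_N by blast
      then have "u' \<oplus>\<^bsub>M\<^esub> u \<in> (Q j \<cdot>\<^bsub>R\<^esub> (T j [^]\<^bsub>ideals_set R\<^esub> n)) \<star> M"
        using Suc uu' by blast
      \<comment> \<open>The inner hypothesis costs one power of T_j; the factor b, itself in T_j,
        restores it.\<close>
      then have "?b \<odot>\<^bsub>M\<^esub> (u' \<oplus>\<^bsub>M\<^esub> u) \<in> (T j \<cdot>\<^bsub>R\<^esub> (Q j \<cdot>\<^bsub>R\<^esub> (T j [^]\<^bsub>ideals_set R\<^esub> n))) \<star> M"
        by (rule ideal_smult_prod[OF T_ideal QT generator_in_T[OF j(3)]])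
      also have "T j \<cdot>\<^bsub>R\<^esub> (Q j \<cdot>\<^bsub>R\<^esub> (T j [^]\<^bsub>ideals_set R\<^esub> n)) =
          Q j \<cdot>\<^bsub>R\<^esub> (T j [^]\<^bsub>ideals_set R\<^esub> Suc n)"
        using R.ideal_prod_commute[OF T_ideal QT]
          R.ideal_prod_assoc[OF Q_ideal[OF j(1)] T_power_ideal T_ideal] by simp
      finally show "z \<in> (Q j \<cdot>\<^bsub>R\<^esub> (T j [^]\<^bsub>ideals_set R\<^esub> Suc n)) \<star> M"
        unfolding z_eq by (rule ideal_smult.sum[OF w])
    qed
  qed
qed

text \<open>Since q = Q_j + T_j, the ideal q T_j^n is Q_j T_j^n + T_j^(n+1). The first summand is
  already in the target; on the second, cancellation leads into q_jM, and
  \<open>relatively_regular_Int_power\<close> supplies the factor Q_j.\<close>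

lemma relatively_regular_imp_power_colon:
  fixes n :: nat
  assumes reg: "relatively_regular" and j: "j < r"
  shows "colon_elem M (N j) (a (Suc j)) \<inter> (Q r \<cdot>\<^bsub>R\<^esub> (T j [^]\<^bsub>ideals_set R\<^esub> n)) \<star> M =
    (Q j \<cdot>\<^bsub>R\<^esub> (T j [^]\<^bsub>ideals_set R\<^esub> n)) \<star> M"
    (is "?L = ?P")
proof (rule equalityI; rule subsetI)
  let ?b = "a (Suc j)" and ?K = "T j [^]\<^bsub>ideals_set R\<^esub> n"
  have jr: "j \<le> r" and b: "?b \<in> carrier R"
    using j seq_closed by auto
  note K = T_power_ideal[of j n]
  have QK: "ideal (Q j \<cdot>\<^bsub>R\<^esub> ?K) R"
    by (rule R.ideal_prod_is_ideal[OF Q_ideal[OF jr] K])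
  have QK_N: "?P \<subseteq> N j"
    using R.ideal_prod_inter[OF Q_ideal[OF jr] K] by (intro ideal_smult_mono) blast
  {
    fix x assume x: "x \<in> ?P"
    have "Q j \<cdot>\<^bsub>R\<^esub> ?K \<subseteq> Q r \<cdot>\<^bsub>R\<^esub> ?K"
      by (rule ideal_prod_mono[OF Q_mono[OF jr order_refl] order_refl])
    then have "x \<in> (Q r \<cdot>\<^bsub>R\<^esub> ?K) \<star> M"
      using x ideal_smult_mono by blast
    moreover have "x \<in> N j"
      using x QK_N by blast
    ultimately show "x \<in> ?L"
      using N_in_carrier[OF jr] submoduleE(4)[OF N_submodule[OF jr] b] by (simp add: colon_elem_def)
  next
    fix x assume x: "x \<in> ?L"
    have "Q r \<cdot>\<^bsub>R\<^esub> ?K = Q j \<cdot>\<^bsub>R\<^esub> ?K <+>\<^bsub>R\<^esub> (T j [^]\<^bsub>ideals_set R\<^esub> Suc n)"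
      unfolding R.ideal_power_Suc_left[OF T_ideal] Q_T_split[OF jr]
      by (rule R.ideal_prod_distr[OF K Q_ideal[OF jr] T_ideal])
    then obtain y z where yz: "y \<in> ?P" "z \<in> (T j [^]\<^bsub>ideals_set R\<^esub> Suc n) \<star> M" "x = y \<oplus>\<^bsub>M\<^esub> z"
      using x ideal_smult_add_iff[OF QK T_power_ideal[of j "Suc n"]] by (metis IntD2)
    have y: "y \<in> N j"
      using yz(1) QK_N by blast
    have z: "z \<in> N r"
      using yz(2) T_power_Suc_subset_N by blast
    have in_carrier: "y \<in> carrier M" "z \<in> carrier M"
      using y z N_in_carrier jr by blast+
    have "?b \<odot>\<^bsub>M\<^esub> y \<oplus>\<^bsub>M\<^esub> ?b \<odot>\<^bsub>M\<^esub> z \<in> N j"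
      using x in_carrier b by (simp add: colon_elem_def yz(3) smult_r_distr)
    then have "?b \<odot>\<^bsub>M\<^esub> z \<in> N j"
      using submodule_add_cancel_left[OF N_submodule[OF jr]]
        submoduleE(4)[OF N_submodule[OF jr] b y] in_carrier b by blast
    then have "z \<in> N j"
      by (rule relatively_regularD[OF reg j z])
    then have "z \<in> ?P"
      using relatively_regular_Int_power[OF reg jr, of n] yz(2) by blast
    then show "x \<in> ?P"
      unfolding yz(3) by (rule ideal_smult.sum[OF yz(1)])
  }
qed

lemma relatively_regular_iff_power_colon:
  "relatively_regular \<longleftrightarrow> (\<forall>n::nat. \<forall>j<r.
    colon_elem M (N j) (a (Suc j)) \<inter> (Q r \<cdot>\<^bsub>R\<^esub> (T j [^]\<^bsub>ideals_set R\<^esub> n)) \<star> M =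
    (Q j \<cdot>\<^bsub>R\<^esub> (T j [^]\<^bsub>ideals_set R\<^esub> n)) \<star> M)"
    (is "_ \<longleftrightarrow> ?C")
proof
  show ?C if "relatively_regular"
    using relatively_regular_imp_power_colon[OF that] by blast
  \<comment> \<open>At n = 0 the ideal powers are the whole ring and (iii) becomes (iv).\<close>
  show "relatively_regular" if C: ?C
    unfolding relatively_regular_iff_colon
    using C[rule_format, where n = 0] Q_ideal[of r] Q_ideal
    by (simp add: R.ideal_prod_one)
qed

section \<open>Conditions (i) and (ii) at a single exponent, read in M\<close>

definition superficial_at :: "nat \<Rightarrow> nat \<Rightarrow> bool" where
  "superficial_at j n \<longleftrightarrow>
    colon_elem M ((Q j <+>\<^bsub>R\<^esub> (Q r [^]\<^bsub>ideals_set R\<^esub> (n + 1))) \<star> M) (a (Suc j)) \<inter> N r =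
    (Q j <+>\<^bsub>R\<^esub> (Q r [^]\<^bsub>ideals_set R\<^esub> n)) \<star> M"

lemma Q_power_ideal: "ideal (Q r [^]\<^bsub>ideals_set R\<^esub> (n::nat)) R"
  by (rule R.ideal_power_is_ideal[OF Q_ideal[OF order_refl]])

text \<open>Accounts for the plain \<open>N r\<close> in \<open>superficial_at\<close>: on passing
  from M/q_jM back to M, the ideal q becomes Q_j + q.\<close>

lemma Q_add_absorb:
  assumes "j \<le> r"
  shows "Q j <+>\<^bsub>R\<^esub> Q r = Q r"
proof -
  have "Q j \<union> Q r = Q r"
    using Q_mono[OF assms order_refl] by blast
  moreover have "Idl\<^bsub>R\<^esub> Q r = Q r"
    using R.genideal_minimal[OF Q_ideal[of r]] R.genideal_self[of "Q r"]
      ideal.Icarr[OF Q_ideal[of r]] by blast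
  ultimately show ?thesis
    using R.union_genideal[OF Q_ideal[OF assms] Q_ideal[OF order_refl]] by simp
qed

text \<open>As q = Q_j + T_j, all mixed terms fall into q_jM: modulo q_jM, powers of q may be
  computed with the tail ideal alone.\<close>

lemma Q_power_smult_subset:
  assumes "j \<le> r"
  shows "(Q j <+>\<^bsub>R\<^esub> (Q r [^]\<^bsub>ideals_set R\<^esub> (n::nat))) \<star> M \<subseteq>
    (Q j <+>\<^bsub>R\<^esub> (T j [^]\<^bsub>ideals_set R\<^esub> n)) \<star> M"
proof
  note N = N_submodule[OF assms]
  fix x assume "x \<in> (Q j <+>\<^bsub>R\<^esub> (Q r [^]\<^bsub>ideals_set R\<^esub> n)) \<star> M"
  then obtain y z where y: "y \<in> N j" and "z \<in> (Q r [^]\<^bsub>ideals_set R\<^esub> n) \<star> M" and x: "x = y \<oplus>\<^bsub>M\<^esub> z"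
    using ideal_smult_add_iff[OF Q_ideal[OF assms] Q_power_ideal] by blast
  then have "z \<in> (Q j <+>\<^bsub>R\<^esub> (T j [^]\<^bsub>ideals_set R\<^esub> n)) \<star> M"
    using sum_power_ideal_smult_subset[OF Q_ideal[OF assms] T_ideal, of j n]
    unfolding Q_T_split[OF assms] by blast
  then obtain y' z' where yz': "y' \<in> N j" "z' \<in> (T j [^]\<^bsub>ideals_set R\<^esub> n) \<star> M" "z = y' \<oplus>\<^bsub>M\<^esub> z'"
    using ideal_smult_add_iff[OF Q_ideal[OF assms] T_power_ideal] by blast
  have "x = (y \<oplus>\<^bsub>M\<^esub> y') \<oplus>\<^bsub>M\<^esub> z'"
    using y yz' submodule_in_carrier[OF N]
      submodule_in_carrier[OF submodule_ideal_smult[OF T_power_ideal]]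
    by (simp add: x M.a_assoc)
  then show "x \<in> (Q j <+>\<^bsub>R\<^esub> (T j [^]\<^bsub>ideals_set R\<^esub> n)) \<star> M"
    using submoduleE(5)[OF N y yz'(1)] yz'(2)
      ideal_smult_add_iff[OF Q_ideal[OF assms] T_power_ideal] by blast
qed

lemma T_subset_Q_power: "T j [^]\<^bsub>ideals_set R\<^esub> (n::nat) \<subseteq> Q r [^]\<^bsub>ideals_set R\<^esub> n"
  by (rule R.ideal_power_mono[OF T_subset_Q])

text \<open>With b = a_(j+1), bx is written as an element of q_jM plus bs with s in q^(n+1) M, and b
  is cancelled from b(x - s). The exponent starts at 1 because s must lie in qM; at exponent 0 the
  condition would say qM = M.\<close>

lemma relatively_regular_imp_superficial_at:
  assumes reg: "relatively_regular" and j: "j < r"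
  shows "superficial_at j (Suc n)"
  unfolding superficial_at_def
proof (rule equalityI; rule subsetI)
  let ?b = "a (Suc j)" and ?T' = "T (Suc j)"
  let ?E = "\<lambda>k::nat. (Q j <+>\<^bsub>R\<^esub> (Q r [^]\<^bsub>ideals_set R\<^esub> k)) \<star> M"
  have jr: "j \<le> r" "Suc j \<le> r" and b: "?b \<in> carrier R"
    using j seq_closed by auto
  note N = N_submodule[OF jr(1)]
  note E_iff = ideal_smult_add_iff[OF Q_ideal[OF jr(1)] Q_power_ideal]
  {
    fix x assume "x \<in> ?E (Suc n)"
    then obtain y z where yz: "y \<in> N j" "z \<in> (Q r [^]\<^bsub>ideals_set R\<^esub> Suc n) \<star> M" "x = y \<oplus>\<^bsub>M\<^esub> z"
      using E_iff by blast
    have z: "z \<in> carrier M"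
      using submodule_in_carrier[OF submodule_ideal_smult[OF Q_power_ideal] yz(2)] .
    have "Q r [^]\<^bsub>ideals_set R\<^esub> Suc n \<subseteq> Q r"
      using R.ideal_prod_inter[OF Q_power_ideal Q_ideal[OF order_refl]] by simp
    then have "z \<in> N r"
      using yz(2) ideal_smult_mono by blast
    then have x_N: "x \<in> N r"
      unfolding yz(3) using yz(1) N_mono[OF jr(1) order_refl]
      by (intro submoduleE(5)[OF N_submodule[OF order_refl]]) blast+
    have "?b \<odot>\<^bsub>M\<^esub> z \<in> (Q r [^]\<^bsub>ideals_set R\<^esub> Suc (Suc n)) \<star> M"
      unfolding R.ideal_power_Suc_left[OF Q_ideal[OF order_refl], of "Suc n"]
      by (rule ideal_smult_prod[OF Q_ideal[OF order_refl] Q_power_ideal generator_in_Q yz(2)])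
        (use j in auto)
    moreover have "?b \<odot>\<^bsub>M\<^esub> y \<in> N j"
      by (rule submoduleE(4)[OF N b yz(1)])
    moreover have "?b \<odot>\<^bsub>M\<^esub> x = ?b \<odot>\<^bsub>M\<^esub> y \<oplus>\<^bsub>M\<^esub> ?b \<odot>\<^bsub>M\<^esub> z"
      using b z submodule_in_carrier[OF N yz(1)] by (simp add: yz(3) smult_r_distr)
    ultimately have "?b \<odot>\<^bsub>M\<^esub> x \<in> ?E (Suc n + 1)"
      unfolding E_iff Suc_eq_plus1[symmetric] by blast
    then show "x \<in> colon_elem M (?E (Suc n + 1)) ?b \<inter> N r"
      using x_N N_in_carrier[of r] by (simp add: colon_elem_def)
  next
    fix x assume x: "x \<in> colon_elem M (?E (Suc n + 1)) ?b \<inter> N r"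
    then have x_in: "x \<in> carrier M" "x \<in> N r" "?b \<odot>\<^bsub>M\<^esub> x \<in> ?E (Suc (Suc n))"
      by (simp_all add: colon_elem_def)
    then obtain y z where yz: "y \<in> N j" "z \<in> (T j [^]\<^bsub>ideals_set R\<^esub> Suc (Suc n)) \<star> M"
      "?b \<odot>\<^bsub>M\<^esub> x = y \<oplus>\<^bsub>M\<^esub> z"
      using Q_power_smult_subset[OF jr(1), of "Suc (Suc n)"]
        ideal_smult_add_iff[OF Q_ideal[OF jr(1)] T_power_ideal] by blast
    obtain v u where vu: "v \<in> (?T' [^]\<^bsub>ideals_set R\<^esub> Suc (Suc n)) \<star> M"
      "u \<in> (T j [^]\<^bsub>ideals_set R\<^esub> Suc n) \<star> M" "z = v \<oplus>\<^bsub>M\<^esub> ?b \<odot>\<^bsub>M\<^esub> u"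
      using ideal_power_smult_split[OF T_ideal b T_Suc[OF j] yz(2)] by blast
    have T_in: "w \<in> carrier M" if "w \<in> (T k [^]\<^bsub>ideals_set R\<^esub> l) \<star> M" for w k and l :: nat
      by (rule submodule_in_carrier[OF submodule_ideal_smult[OF T_power_ideal] that])
    note in_carrier = x_in(1) N_in_carrier[OF jr(1) yz(1)] T_in[OF vu(1)] T_in[OF vu(2)]
    \<comment> \<open>In bx = y + v + bu every term other than v visibly lies in q_(j+1)M, hence so
      does v.\<close>
    have "y \<oplus>\<^bsub>M\<^esub> ?b \<odot>\<^bsub>M\<^esub> u \<in> N (Suc j)"
      using yz(1) N_mono[of j "Suc j"] generator_smult_in_N[OF _ jr(2) in_carrier(4), of "Suc j"] jr
      by (intro submoduleE(5)[OF N_submodule[OF jr(2)]]) auto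
    moreover have "v \<oplus>\<^bsub>M\<^esub> (y \<oplus>\<^bsub>M\<^esub> ?b \<odot>\<^bsub>M\<^esub> u) = ?b \<odot>\<^bsub>M\<^esub> x"
      using in_carrier b by (simp add: yz(3) vu(3) M.a_ac)
    moreover have "?b \<odot>\<^bsub>M\<^esub> x \<in> N (Suc j)"
      using generator_smult_in_N[OF _ jr(2) x_in(1), of "Suc j"] by simp
    ultimately have "v \<in> N (Suc j)"
      using submodule_add_cancel_right[OF N_submodule[OF jr(2)] in_carrier(3)] by metis
    then have "v \<in> (Q (Suc j) \<cdot>\<^bsub>R\<^esub> (?T' [^]\<^bsub>ideals_set R\<^esub> Suc n)) \<star> M"
      using relatively_regular_Int_power[OF reg jr(2), of "Suc n"] vu(1) by blast
    then obtain w u' where wu: "w \<in> (Q j \<cdot>\<^bsub>R\<^esub> (?T' [^]\<^bsub>ideals_set R\<^esub> Suc n)) \<star> M"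
      "u' \<in> (?T' [^]\<^bsub>ideals_set R\<^esub> Suc n) \<star> M" "v = w \<oplus>\<^bsub>M\<^esub> ?b \<odot>\<^bsub>M\<^esub> u'"
      using ideal_smult_prod_split[OF Q_ideal[OF jr(1)] T_power_ideal b] Q_Suc[OF j] by metis
    have w: "w \<in> N j"
      using ideal_smult_mono[of "Q j \<cdot>\<^bsub>R\<^esub> (?T' [^]\<^bsub>ideals_set R\<^esub> Suc n)" "Q j"] wu(1)
        R.ideal_prod_inter[OF Q_ideal[OF jr(1)] T_power_ideal] by blast
    define s where "s = u' \<oplus>\<^bsub>M\<^esub> u"
    have u'_in: "u' \<in> carrier M" and w_in: "w \<in> carrier M"
      using T_in[OF wu(2)] N_in_carrier[OF jr(1) w] .
    then have s_in: "s \<in> carrier M"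
      using in_carrier by (simp add: s_def)
    have s_pow: "s \<in> (Q r [^]\<^bsub>ideals_set R\<^esub> Suc n) \<star> M"
      unfolding s_def
      using ideal_smult_mono[OF T_subset_Q_power, of "Suc j" "Suc n"] wu(2)
        ideal_smult_mono[OF T_subset_Q_power, of j "Suc n"] vu(2)
      by (intro submoduleE(5)[OF submodule_ideal_smult[OF Q_power_ideal]]) blast+
    have s_N: "s \<in> N r"
    proof -
      have "u' \<in> N r" "u \<in> N r"
        using T_power_Suc_subset_N wu(2) vu(2) by blast+
      then show ?thesis
        unfolding s_def by (rule submoduleE(5)[OF N_submodule[OF order_refl]])
    qed
    \<comment> \<open>This is x - s. Since bs absorbs bu' + bu, what is left is bt = y + w in q_jM,
      and t is in qM, so b cancels.\<close>
    define t where "t = x \<oplus>\<^bsub>M\<^esub> \<ominus>\<^bsub>M\<^esub> s"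
    have x_eq: "x = t \<oplus>\<^bsub>M\<^esub> s"
      using x_in(1) s_in by (simp add: t_def M.a_assoc M.l_neg)
    have t_in: "t \<in> carrier M"
      using x_in(1) s_in by (simp add: t_def)
    have "t \<in> N r"
      unfolding t_def using x_in(2) submoduleE(3)[OF N_submodule[OF order_refl] s_N]
      by (rule submoduleE(5)[OF N_submodule[OF order_refl]])
    moreover have "?b \<odot>\<^bsub>M\<^esub> t \<in> N j"
    proof -
      have "?b \<odot>\<^bsub>M\<^esub> t \<oplus>\<^bsub>M\<^esub> ?b \<odot>\<^bsub>M\<^esub> s = (y \<oplus>\<^bsub>M\<^esub> w) \<oplus>\<^bsub>M\<^esub> ?b \<odot>\<^bsub>M\<^esub> s"
      proof -
        have "?b \<odot>\<^bsub>M\<^esub> t \<oplus>\<^bsub>M\<^esub> ?b \<odot>\<^bsub>M\<^esub> s = ?b \<odot>\<^bsub>M\<^esub> x"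
          using b t_in s_in by (simp add: x_eq smult_r_distr)
        also have "\<dots> = (y \<oplus>\<^bsub>M\<^esub> w) \<oplus>\<^bsub>M\<^esub> (?b \<odot>\<^bsub>M\<^esub> u' \<oplus>\<^bsub>M\<^esub> ?b \<odot>\<^bsub>M\<^esub> u)"
          using b in_carrier u'_in w_in by (simp add: yz(3) vu(3) wu(3) M.a_assoc)
        finally show ?thesis
          using b in_carrier u'_in by (simp add: s_def smult_r_distr)
      qed
      then have "?b \<odot>\<^bsub>M\<^esub> t = y \<oplus>\<^bsub>M\<^esub> w"
        using b t_in s_in in_carrier w_in M.add.right_cancel by simp
      then show ?thesis
        using submoduleE(5)[OF N yz(1) w] by simp
    qed
    ultimately have "t \<in> N j"
      using relatively_regularD[OF reg j] by blast
    then show "x \<in> ?E (Suc n)"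
      unfolding E_iff x_eq using s_pow by blast
  }
qed

text \<open>With N = q_jM and b = a_(j+1), there is a cycle of inclusions N:b, N:q, N:q^n, N:b^n,
  N:b. Regularity enters in the first and the last: x is multiplied by an element of q, which places
  it in qM, and there b cancels.\<close>

lemma relatively_regular_imp_colon_eq:
  fixes k n :: nat
  assumes reg: "relatively_regular" and j: "j < r" and "1 \<le> k" "1 \<le> n"
  shows "colon_elem M (N j) (a (Suc j) [^]\<^bsub>R\<^esub> k) =
    colon_ideal M (N j) (Q r [^]\<^bsub>ideals_set R\<^esub> n)"
proof -
  let ?b = "a (Suc j)" and ?q = "Q r"
  have jr: "j \<le> r" and b: "?b \<in> carrier R" and bq: "?b \<in> ?q"
    using j seq_closed generator_in_Q[of "Suc j" r] by auto
  note q = Q_ideal[OF order_refl]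
  have pow: "x \<in> colon_elem M (N j) ?b" if "x \<in> colon_elem M (N j) (?b [^]\<^bsub>R\<^esub> Suc l)" for x l
    using that
  proof (induction l)
    case (Suc l)
    have x: "x \<in> carrier M"
      using Suc.prems by (simp add: colon_elem_def)
    have "?b [^]\<^bsub>R\<^esub> Suc l \<in> ?q"
      using ideal.I_l_closed[OF q bq] b by simp
    then have "(?b [^]\<^bsub>R\<^esub> Suc l) \<odot>\<^bsub>M\<^esub> x \<in> N r"
      using x by (rule ideal_smult.smult)
    moreover have "?b \<odot>\<^bsub>M\<^esub> ((?b [^]\<^bsub>R\<^esub> Suc l) \<odot>\<^bsub>M\<^esub> x) \<in> N j"
    proof -
      have "?b [^]\<^bsub>R\<^esub> Suc (Suc l) = ?b \<otimes>\<^bsub>R\<^esub> (?b [^]\<^bsub>R\<^esub> Suc l)"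
        by (rule R.nat_pow_Suc2[OF b])
      moreover have "(?b [^]\<^bsub>R\<^esub> Suc (Suc l)) \<odot>\<^bsub>M\<^esub> x \<in> N j"
        using Suc.prems by (simp only: colon_elem_def mem_Collect_eq)
      ultimately show ?thesis
        using smult_assoc1[OF b R.nat_pow_closed[OF b, of "Suc l"] x] by metis
    qed
    ultimately have "(?b [^]\<^bsub>R\<^esub> Suc l) \<odot>\<^bsub>M\<^esub> x \<in> N j"
      by (rule relatively_regularD[OF reg j])
    then show ?case
      by (intro Suc.IH) (simp only: colon_elem_def mem_Collect_eq x)
  qed (use b in simp)
  have base: "colon_elem M (N j) ?b \<subseteq> colon_ideal M (N j) ?q"
  proof
    fix x assume "x \<in> colon_elem M (N j) ?b"
    then have x: "x \<in> carrier M" "?b \<odot>\<^bsub>M\<^esub> x \<in> N j"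
      by (simp_all add: colon_elem_def)
    have "a i \<odot>\<^bsub>M\<^esub> x \<in> N j" if i: "i \<in> {1..r}" for i
    proof (rule relatively_regularD[OF reg j])
      show "a i \<odot>\<^bsub>M\<^esub> x \<in> N r"
        by (rule generator_smult_in_N[OF i order_refl x(1)])
      show "?b \<odot>\<^bsub>M\<^esub> (a i \<odot>\<^bsub>M\<^esub> x) \<in> N j"
        using submoduleE(4)[OF N_submodule[OF jr] seq_closed[OF i] x(2)]
          smult_commute[OF b seq_closed[OF i] x(1)] by simp
    qed
    then show "x \<in> colon_ideal M (N j) ?q"
      by (simp add: colon_ideal_Q N_submodule jr x(1))
  qed
  obtain l where k: "k = Suc l"
    using \<open>1 \<le> k\<close> by (cases k) auto
  obtain p where n: "n = Suc p"
    using \<open>1 \<le> n\<close> by (cases n) auto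
  have "?q [^]\<^bsub>ideals_set R\<^esub> n \<subseteq> ?q"
    using R.ideal_prod_inter[OF Q_power_ideal q] by (simp add: n)
  then have *: "colon_ideal M (N j) ?q \<subseteq> colon_ideal M (N j) (?q [^]\<^bsub>ideals_set R\<^esub> n)"
    by (auto simp: colon_ideal_def)
  have "?b [^]\<^bsub>R\<^esub> i \<in> ?q [^]\<^bsub>ideals_set R\<^esub> i" for i :: nat
    by (induction i) (use bq in \<open>auto intro: ideal_prod.prod\<close>)
  from this[of n] have "colon_ideal M (N j) (?q [^]\<^bsub>ideals_set R\<^esub> n) \<subseteq> colon_elem M (N j) (?b [^]\<^bsub>R\<^esub> n)"
    by (auto simp: colon_ideal_def colon_elem_def)
  moreover have "colon_elem M (N j) (?b [^]\<^bsub>R\<^esub> n) \<subseteq> colon_elem M (N j) ?b"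
    unfolding n using pow by blast
  moreover have "colon_elem M (N j) (?b [^]\<^bsub>R\<^esub> k) \<subseteq> colon_elem M (N j) ?b"
    unfolding k using pow by blast
  moreover have "colon_elem M (N j) ?b \<subseteq> colon_elem M (N j) (?b [^]\<^bsub>R\<^esub> k)"
    unfolding k using b submoduleE(4)[OF N_submodule[OF jr]]
    by (auto simp: colon_elem_def smult_assoc1)
  ultimately show ?thesis
    using base * by blast
qed

text \<open>Phrased with the one inclusion of (v) that can also be derived from (vii).\<close>

lemma relatively_regularI_square:
  assumes sq: "\<And>j x. \<lbrakk>j < r; x \<in> carrier M; a (Suc j) \<odot>\<^bsub>M\<^esub> (a (Suc j) \<odot>\<^bsub>M\<^esub> x) \<in> N j\<rbrakk>
      \<Longrightarrow> x \<in> colon_ideal M (N j) (Q r)"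
  shows "relatively_regular"
  unfolding relatively_regular_def
proof (intro allI impI ballI)
  fix j x assume j: "j < r" and x: "x \<in> N r" and bx: "a (Suc j) \<odot>\<^bsub>M\<^esub> x \<in> N j"
  have x_in: "x \<in> carrier M"
    using N_in_carrier[OF _ x] by simp
  \<comment> \<open>Multiplying bx by b once more makes the premise applicable to x itself, so all
    of q kills x modulo q_jM.\<close>
  have "a (Suc j) \<odot>\<^bsub>M\<^esub> (a (Suc j) \<odot>\<^bsub>M\<^esub> x) \<in> N j"
    using submoduleE(4)[OF N_submodule seq_closed bx] j by simp
  then have "x \<in> colon_ideal M (N j) (Q r)"
    using sq[OF j x_in] by blast
  then have ax: "a i \<odot>\<^bsub>M\<^esub> x \<in> N j" if "i \<in> {1..r}" for i
    using that j colon_ideal_Q[OF N_submodule[of j], of r] by simp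
  have "x \<in> N k" if "j \<le> k" "k \<le> r" for k
    using that(2,1)
  proof (induction k rule: inc_induct)
    case base
    show ?case by (rule x)
  next
    case (step k)
    let ?b = "a (Suc k)"
    have b: "?b \<in> carrier R" and k: "k \<le> r"
      using step.hyps seq_closed by auto
    obtain y z where yz: "y \<in> N k" "z \<in> carrier M" "x = y \<oplus>\<^bsub>M\<^esub> ?b \<odot>\<^bsub>M\<^esub> z"
      using N_Suc_split step by (metis le_SucI)
    \<comment> \<open>Now b = a_(k+1) and x = y + bz. The vector bx lies in q_jM, hence in q_kM, and
      so does by; thus b^2 z lies in q_kM.\<close>
    have "?b \<odot>\<^bsub>M\<^esub> y \<oplus>\<^bsub>M\<^esub> ?b \<odot>\<^bsub>M\<^esub> (?b \<odot>\<^bsub>M\<^esub> z) \<in> N k"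
      using ax[of "Suc k"] N_mono[of j k] step.hyps step.prems b yz N_in_carrier[OF k yz(1)]
      by (auto simp: smult_r_distr)
    then have "?b \<odot>\<^bsub>M\<^esub> (?b \<odot>\<^bsub>M\<^esub> z) \<in> N k"
      using submodule_add_cancel_left[OF N_submodule[OF k]]
        submoduleE(4)[OF N_submodule[OF k] b yz(1)] b yz(2) by blast
    then have "z \<in> colon_ideal M (N k) (Q r)"
      using sq step.hyps yz(2) by blast
    then have "?b \<odot>\<^bsub>M\<^esub> z \<in> N k"
      using colon_ideal_Q[OF N_submodule[OF k], of r] step.hyps by simp
    then show "x \<in> N k"
      unfolding yz(3) by (rule submoduleE(5)[OF N_submodule[OF k] yz(1)])
  qed
  then show "x \<in> N j"
    using j by simp
qed

lemma relatively_regular_iff_colon_square: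
  "relatively_regular \<longleftrightarrow>
    (\<forall>j<r. colon_elem M (N j) (a (Suc j) [^]\<^bsub>R\<^esub> (2::nat)) = colon_ideal M (N j) (Q r))"
    (is "_ \<longleftrightarrow> ?C")
proof
  \<comment> \<open>The first power of q unfolds to R q, because the empty power is R; the two
    product rules remove this factor.\<close>
  show ?C if "relatively_regular"
    using relatively_regular_imp_colon_eq[OF that, of _ 2 1] Q_ideal[of r]
    by (simp add: R.ideal_prod_commute[OF R.oneideal] R.ideal_prod_one)
  show "relatively_regular" if C: ?C
  proof (rule relatively_regularI_square)
    fix j x
    assume j: "j < r" and "x \<in> carrier M" "a (Suc j) \<odot>\<^bsub>M\<^esub> (a (Suc j) \<odot>\<^bsub>M\<^esub> x) \<in> N j"
    then have "x \<in> colon_elem M (N j) (a (Suc j) [^]\<^bsub>R\<^esub> (2::nat))"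
      using seq_closed[of "Suc j"] by (simp add: colon_elem_def numeral_2_eq_2 smult_assoc1)
    then show "x \<in> colon_ideal M (N j) (Q r)"
      using C j by blast
  qed
qed

lemma relatively_regular_iff_colon_powers:
  "relatively_regular \<longleftrightarrow> (\<forall>k\<ge>1. \<forall>n\<ge>1. \<forall>j<r.
    colon_elem M (N j) (a (Suc j) [^]\<^bsub>R\<^esub> (k::nat)) =
    colon_ideal M (N j) (Q r [^]\<^bsub>ideals_set R\<^esub> (n::nat)))"
    (is "_ \<longleftrightarrow> ?C")
proof
  show ?C if "relatively_regular"
    using relatively_regular_imp_colon_eq[OF that] by blast
  show "relatively_regular" if C: ?C
    unfolding relatively_regular_iff_colon_square
    using C[rule_format, of 2 1] Q_ideal[of r]
    by (simp add: R.ideal_prod_commute[OF R.oneideal] R.ideal_prod_one)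
qed

end

section \<open>Saturation and associated primes\<close>

context sequence_in_ring
begin

text \<open>Its image in M/P is the q-power torsion of M/P. Exponents start at 1 as in (vii); the
  colons grow with \<open>n\<close>, so \<open>saturationI\<close> may accept exponent 0.\<close>

definition saturation :: "'c set \<Rightarrow> 'c set" where
  "saturation P = (\<Union>n\<in>{1::nat..}. colon_ideal M P (Q r [^]\<^bsub>ideals_set R\<^esub> n))"

lemma colon_Q_power_Suc:
  assumes "submodule P R M"
  shows "colon_ideal M P (Q r [^]\<^bsub>ideals_set R\<^esub> Suc n) =
    colon_ideal M (colon_ideal M P (Q r [^]\<^bsub>ideals_set R\<^esub> n)) (Q r)"
  using colon_ideal_ideal_prod[OF assms Q_power_ideal Q_ideal[OF order_refl]] by simp

lemma submodule_colon_Q_power: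
  "submodule P R M \<Longrightarrow> submodule (colon_ideal M P (Q r [^]\<^bsub>ideals_set R\<^esub> (n::nat))) R M"
  using ideal.Icarr[OF Q_power_ideal] by (intro submodule_colon_ideal) blast+

lemma colon_Q_power_mono:
  fixes k n :: nat
  assumes "k \<le> n"
  shows "colon_ideal M P (Q r [^]\<^bsub>ideals_set R\<^esub> k) \<subseteq> colon_ideal M P (Q r [^]\<^bsub>ideals_set R\<^esub> n)"
  using R.ideal_power_antimono[OF Q_ideal[OF order_refl] assms] by (auto simp: colon_ideal_def)

lemma saturationI:
  fixes n :: nat
  assumes "x \<in> colon_ideal M P (Q r [^]\<^bsub>ideals_set R\<^esub> n)"
  shows "x \<in> saturation P"
  unfolding saturation_def
proof (rule UN_I)
  show "Suc n \<in> {1..}"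
    by simp
  show "x \<in> colon_ideal M P (Q r [^]\<^bsub>ideals_set R\<^esub> Suc n)"
    by (rule subsetD[OF colon_Q_power_mono assms]) simp
qed

lemma saturationE:
  assumes "x \<in> saturation P"
  obtains n :: nat where "x \<in> colon_ideal M P (Q r [^]\<^bsub>ideals_set R\<^esub> n)"
  using assms unfolding saturation_def by blast

lemma submodule_saturation:
  assumes P: "submodule P R M"
  shows "submodule (saturation P) R M"
proof (rule submoduleI)
  note sub = submoduleE[OF submodule_colon_Q_power[OF P]]
  show "saturation P \<subseteq> carrier M"
    using sub(1) by (auto simp: saturation_def)
  show "\<zero>\<^bsub>M\<^esub> \<in> saturation P"
    by (rule saturationI[OF submodule_zero[OF submodule_colon_Q_power[OF P]]])
  show "\<ominus>\<^bsub>M\<^esub> x \<in> saturation P" if "x \<in> saturation P" for x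
    using that by (rule saturationE) (rule saturationI[OF sub(3)])
  show "c \<odot>\<^bsub>M\<^esub> x \<in> saturation P" if "c \<in> carrier R" "x \<in> saturation P" for c x
    using that(2) by (rule saturationE) (rule saturationI[OF sub(4)[OF that(1)]])
  show "x \<oplus>\<^bsub>M\<^esub> y \<in> saturation P" if xy: "x \<in> saturation P" "y \<in> saturation P" for x y
  proof -
    obtain k :: nat where k: "x \<in> colon_ideal M P (Q r [^]\<^bsub>ideals_set R\<^esub> k)"
      using xy(1) by (rule saturationE)
    obtain l :: nat where l: "y \<in> colon_ideal M P (Q r [^]\<^bsub>ideals_set R\<^esub> l)"
      using xy(2) by (rule saturationE)
    show ?thesis
      by (rule saturationI[OF sub(5)[OF subsetD[OF colon_Q_power_mono[OF max.cobounded1] k]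
            subsetD[OF colon_Q_power_mono[OF max.cobounded2] l]]])
  qed
qed

lemma finite_subset_saturation:
  assumes "finite S" "S \<subseteq> saturation P"
  shows "\<exists>n::nat. S \<subseteq> colon_ideal M P (Q r [^]\<^bsub>ideals_set R\<^esub> n)"
  using assms
proof (induction S rule: finite_induct)
  case (insert x S)
  then obtain k :: nat where k: "S \<subseteq> colon_ideal M P (Q r [^]\<^bsub>ideals_set R\<^esub> k)"
    by auto
  obtain l :: nat where l: "x \<in> colon_ideal M P (Q r [^]\<^bsub>ideals_set R\<^esub> l)"
    using insert.prems by (auto elim: saturationE)
  have "insert x S \<subseteq> colon_ideal M P (Q r [^]\<^bsub>ideals_set R\<^esub> max k l)"
    using subset_trans[OF k colon_Q_power_mono[OF max.cobounded1]]
      subsetD[OF colon_Q_power_mono[OF max.cobounded2] l] by simp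
  then show ?case ..
qed simp

lemma saturation_mono: "P \<subseteq> P' \<Longrightarrow> saturation P \<subseteq> saturation P'"
  by (auto simp: saturation_def colon_ideal_def)

lemma subset_saturation:
  assumes "submodule P R M"
  shows "P \<subseteq> saturation P"
proof
  fix x assume "x \<in> P"
  then have "x \<in> colon_ideal M P (Q r [^]\<^bsub>ideals_set R\<^esub> (0::nat))"
    using submoduleE(1,4)[OF assms] by (auto simp: colon_ideal_def)
  then show "x \<in> saturation P"
    by (rule saturationI)
qed

text \<open>Finitely many generators of q admit a common exponent n, and then x is killed by q^(n+1)
  modulo \<open>P\<close>.\<close>

lemma saturationI_generators:
  assumes P: "submodule P R M" and x: "x \<in> carrier M"
    and gen: "\<And>i. i \<in> {1..r} \<Longrightarrow> a i \<odot>\<^bsub>M\<^esub> x \<in> saturation P"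
  shows "x \<in> saturation P"
proof -
  have "(\<lambda>i. a i \<odot>\<^bsub>M\<^esub> x) ` {1..r} \<subseteq> saturation P"
    using gen by blast
  then obtain n :: nat
    where n: "(\<lambda>i. a i \<odot>\<^bsub>M\<^esub> x) ` {1..r} \<subseteq> colon_ideal M P (Q r [^]\<^bsub>ideals_set R\<^esub> n)"
    using finite_subset_saturation by blast
  then have "x \<in> colon_ideal M P (Q r [^]\<^bsub>ideals_set R\<^esub> Suc n)"
    unfolding colon_Q_power_Suc[OF P] colon_ideal_Q[OF submodule_colon_Q_power[OF P] order_refl]
    using x by blast
  then show ?thesis
    by (rule saturationI)
qed

text \<open>Classically, each monomial of high degree in the a_i contains a high power of one of
  them. Here monomials are not counted; the generators are brought down to exponent 1 one after the
  other.\<close>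

lemma saturationI_generator_powers:
  assumes P: "submodule P R M" and x: "x \<in> carrier M"
    and pow: "\<And>i. i \<in> {1..r} \<Longrightarrow> \<exists>n::nat. (a i [^]\<^bsub>R\<^esub> n) \<odot>\<^bsub>M\<^esub> x \<in> saturation P"
  shows "x \<in> saturation P"
proof -
  note S = submodule_saturation[OF P]
  \<comment> \<open>\<open>k\<close> counts the generators of which only some power is known to
    work; the later ones work with exponent 1. At k = 0 this is
    \<open>saturationI_generators\<close>.\<close>
  have "y \<in> saturation P"
    if "k \<le> r" "y \<in> carrier M"
      "\<forall>i\<in>{1..k}. \<exists>n::nat. (a i [^]\<^bsub>R\<^esub> n) \<odot>\<^bsub>M\<^esub> y \<in> saturation P"
      "\<forall>i\<in>{Suc k..r}. a i \<odot>\<^bsub>M\<^esub> y \<in> saturation P" for k y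
    using that
  proof (induction k arbitrary: y)
    case 0
    show ?case
      by (rule saturationI_generators[OF P]) (use 0 in auto)
  next
    case (Suc k)
    let ?b = "a (Suc k)"
    have b: "?b \<in> carrier R"
      using Suc.prems(1) seq_closed by simp
    note pow_y = Suc.prems(3) and last_y = Suc.prems(4) and IH = Suc.IH
    have smult_pow: "c \<odot>\<^bsub>M\<^esub> ((?b [^]\<^bsub>R\<^esub> n) \<odot>\<^bsub>M\<^esub> y) \<in> saturation P"
      if "c \<in> carrier R" "c \<odot>\<^bsub>M\<^esub> y \<in> saturation P" for c and n :: nat
      using that submoduleE(4)[OF S R.nat_pow_closed[OF b], of "c \<odot>\<^bsub>M\<^esub> y" n]
        smult_commute[OF that(1) R.nat_pow_closed[OF b] Suc.prems(2)] by simp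
    \<comment> \<open>The exponent drops by one at a time: b itself carries y' = b^n y into the
      saturation, so b joins the second group and the hypothesis for \<open>k\<close> applies to
      y'.\<close>
    have descend: "y \<in> saturation P" if "(?b [^]\<^bsub>R\<^esub> n) \<odot>\<^bsub>M\<^esub> y \<in> saturation P" for n :: nat
      using that
    proof (induction n)
      case 0
      then show ?case
        using Suc.prems(2) by simp
    next
      case (Suc n)
      note step = Suc
      let ?y' = "(?b [^]\<^bsub>R\<^esub> n) \<odot>\<^bsub>M\<^esub> y"
      have y': "?y' \<in> carrier M"
        using b \<open>y \<in> carrier M\<close> by simp
      have "?y' \<in> saturation P"
      proof (rule IH)
        show "k \<le> r"
          using \<open>Suc k \<le> r\<close> by simp
        show "?y' \<in> carrier M"
          by (rule y')
        show "\<forall>i\<in>{1..k}. \<exists>l::nat. (a i [^]\<^bsub>R\<^esub> l) \<odot>\<^bsub>M\<^esub> ?y' \<in> saturation P"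
        proof
          fix i assume i: "i \<in> {1..k}"
          then obtain l :: nat where "(a i [^]\<^bsub>R\<^esub> l) \<odot>\<^bsub>M\<^esub> y \<in> saturation P"
            using pow_y by force
          then have "(a i [^]\<^bsub>R\<^esub> l) \<odot>\<^bsub>M\<^esub> ?y' \<in> saturation P"
            using i \<open>Suc k \<le> r\<close> seq_closed[of i] by (intro smult_pow) auto
          then show "\<exists>l::nat. (a i [^]\<^bsub>R\<^esub> l) \<odot>\<^bsub>M\<^esub> ?y' \<in> saturation P" ..
        qed
        show "\<forall>i\<in>{Suc k..r}. a i \<odot>\<^bsub>M\<^esub> ?y' \<in> saturation P"
        proof
          fix i assume i: "i \<in> {Suc k..r}"
          show "a i \<odot>\<^bsub>M\<^esub> ?y' \<in> saturation P"
          proof (cases "i = Suc k")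
            case True
            have "(?b [^]\<^bsub>R\<^esub> Suc n) \<odot>\<^bsub>M\<^esub> y = ?b \<odot>\<^bsub>M\<^esub> ?y'"
              using b \<open>y \<in> carrier M\<close> R.nat_pow_Suc2[OF b, of n]
              by (simp add: smult_assoc1 del: R.nat_pow_Suc)
            then show ?thesis
              using step(2) True by simp
          next
            case False
            then show ?thesis
              using i last_y seq_closed[of i] by (intro smult_pow) auto
          qed
        qed
      qed
      then show ?case
        by (rule step(1))
    qed
    have "Suc k \<in> {1..Suc k}"
      by simp
    then show ?case
      using Suc.prems(3) descend by blast
  qed
  from this[of r x] show ?thesis
    using x pow by simp
qed

text \<open>Will be read contrapositively: for y outside the saturation and any n, some s in q^n
  keeps sy outside.\<close>

lemma colon_saturation_Q_power:
  assumes P: "submodule P R M"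
  shows "colon_ideal M (saturation P) (Q r [^]\<^bsub>ideals_set R\<^esub> (n::nat)) = saturation P"
proof (induction n)
  case 0
  have "x \<in> saturation P" if "x \<in> carrier M" "\<forall>c\<in>carrier R. c \<odot>\<^bsub>M\<^esub> x \<in> saturation P" for x
    using that(2)[rule_format, of "\<one>\<^bsub>R\<^esub>"] that(1) by simp
  then show ?case
    using submoduleE(1,4)[OF submodule_saturation[OF P]] by (auto simp: colon_ideal_def)
next
  case (Suc n)
  have "colon_ideal M (saturation P) (Q r) = saturation P"
  proof
    show "colon_ideal M (saturation P) (Q r) \<subseteq> saturation P"
      using saturationI_generators[OF P]
      by (auto simp: colon_ideal_Q[OF submodule_saturation[OF P] order_refl])
    show "saturation P \<subseteq> colon_ideal M (saturation P) (Q r)"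
      using submoduleE(1,4)[OF submodule_saturation[OF P]] seq_closed
      by (auto simp: colon_ideal_Q[OF submodule_saturation[OF P] order_refl])
  qed
  then show ?case
    unfolding colon_Q_power_Suc[OF submodule_saturation[OF P]] Suc .
qed

text \<open>
  A colon \<open>P : y\<close> that is maximal among those with \<open>y\<close> a multiple of \<open>x\<close> outside the saturation
  is an associated prime of \<open>M / P\<close> that contains \<open>b\<close> but not \<open>q\<close>.
\<close>

lemma in_saturation_if_outside_associated_primes:
  assumes noeth: "noetherian_ring R" and P: "submodule P R M" and b: "b \<in> carrier R"
    and outside: "\<forall>p \<in> Ass R (quotient_module M P) - prime_locus R (Q r). b \<notin> p"
    and x: "x \<in> carrier M" and bbx: "b \<odot>\<^bsub>M\<^esub> (b \<odot>\<^bsub>M\<^esub> x) \<in> P"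
  shows "x \<in> saturation P"
proof (rule ccontr)
  assume x_notin: "x \<notin> saturation P"
  interpret noetherian_ring R by fact
  note S = submodule_saturation[OF P]
  define ann where "ann y = {c \<in> carrier R. c \<odot>\<^bsub>M\<^esub> y \<in> P}" for y
  have ann_ideal: "ideal (ann y) R" if "y \<in> carrier M" for y
    unfolding ann_def by (rule ideal_of_vector_colon[OF P that])
  \<comment> \<open>Restricting to multiples of \<open>x\<close> makes b^2 carry every candidate
    into \<open>P\<close>; primality will then put b into the annihilator.\<close>
  define Y where "Y = {d \<odot>\<^bsub>M\<^esub> x | d. d \<in> carrier R \<and> d \<odot>\<^bsub>M\<^esub> x \<notin> saturation P}"
  have Y_in: "y \<in> carrier M" if "y \<in> Y" for y
    using that x by (auto simp: Y_def)
  have "x \<in> Y"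
    unfolding Y_def using x x_notin by (intro CollectI exI[of _ "\<one>\<^bsub>R\<^esub>"]) simp
  then have "ann ` Y \<noteq> {}"
    by blast
  then have "\<exists>I\<in>ann ` Y. \<forall>J\<in>ann ` Y. I \<subseteq> J \<longrightarrow> J = I"
    using Y_in ann_ideal by (intro exists_maximal_ideal_in_family) auto
  then obtain y where y: "y \<in> Y" and max: "\<And>y'. \<lbrakk>y' \<in> Y; ann y \<subseteq> ann y'\<rbrakk> \<Longrightarrow> ann y' = ann y"
    unfolding bex_simps ball_simps by blast
  have y_in: "y \<in> carrier M" and y_sat: "y \<notin> saturation P"
    using y Y_in by (auto simp: Y_def)
  \<comment> \<open>Multiplication can only enlarge an annihilator, so by maximality nothing changes
    as long as the multiple stays outside the saturation.\<close>
  have multiple: "ann (s \<odot>\<^bsub>M\<^esub> y) = ann y" if s: "s \<in> carrier R" and "s \<odot>\<^bsub>M\<^esub> y \<notin> saturation P" for s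
  proof (rule max)
    obtain d where "d \<in> carrier R" "y = d \<odot>\<^bsub>M\<^esub> x"
      using y by (auto simp: Y_def)
    then have "s \<odot>\<^bsub>M\<^esub> y = (s \<otimes>\<^bsub>R\<^esub> d) \<odot>\<^bsub>M\<^esub> x" "s \<otimes>\<^bsub>R\<^esub> d \<in> carrier R"
      using s x by (simp_all add: smult_assoc1)
    then show "s \<odot>\<^bsub>M\<^esub> y \<in> Y"
      using that(2) unfolding Y_def by auto
    show "ann y \<subseteq> ann (s \<odot>\<^bsub>M\<^esub> y)"
      using submoduleE(4)[OF P s] smult_commute[OF _ s y_in] by (auto simp: ann_def)
  qed
  have prime: "primeideal (ann y) R"
  proof (rule primeidealI)
    show "ideal (ann y) R" "cring R"
      by (rule ann_ideal[OF y_in]) (rule R.is_cring)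
    have "y \<notin> P"
      using y_sat subset_saturation[OF P] by blast
    then have "\<one>\<^bsub>R\<^esub> \<notin> ann y"
      using y_in by (simp add: ann_def)
    then show "carrier R \<noteq> ann y"
      by auto
    fix c d assume c: "c \<in> carrier R" and d: "d \<in> carrier R" and cd: "c \<otimes>\<^bsub>R\<^esub> d \<in> ann y"
    have cdy: "c \<odot>\<^bsub>M\<^esub> (d \<odot>\<^bsub>M\<^esub> y) \<in> P"
      using cd c d y_in by (simp add: ann_def smult_assoc1)
    show "c \<in> ann y \<or> d \<in> ann y"
    proof (cases "d \<odot>\<^bsub>M\<^esub> y \<in> saturation P")
      case False
      have "c \<in> ann (d \<odot>\<^bsub>M\<^esub> y)"
        using c cdy by (simp add: ann_def)
      then show ?thesis
        using multiple[OF d False] by simp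
    next
      case True
      then obtain n :: nat where n: "d \<odot>\<^bsub>M\<^esub> y \<in> colon_ideal M P (Q r [^]\<^bsub>ideals_set R\<^esub> n)"
        by (rule saturationE)
      \<comment> \<open>All of q^n carries dy into \<open>P\<close>, while some s in q^n leaves sy
        outside the saturation. Then d annihilates sy modulo \<open>P\<close>, and sy has the same
        annihilator as y.\<close>
      obtain s where s: "s \<in> Q r [^]\<^bsub>ideals_set R\<^esub> n" "s \<odot>\<^bsub>M\<^esub> y \<notin> saturation P"
        using y_sat y_in colon_saturation_Q_power[OF P, of n] by (auto simp: colon_ideal_def)
      have s_in: "s \<in> carrier R"
        by (rule ideal.Icarr[OF Q_power_ideal s(1)])
      have "d \<odot>\<^bsub>M\<^esub> (s \<odot>\<^bsub>M\<^esub> y) \<in> P"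
        using n s(1) smult_commute[OF d s_in y_in] by (simp add: colon_ideal_def)
      then have "d \<in> ann (s \<odot>\<^bsub>M\<^esub> y)"
        using d by (simp add: ann_def)
      then show ?thesis
        using multiple[OF s_in s(2)] by simp
    qed
  qed
  have "ann y \<in> Ass R (quotient_module M P)"
    unfolding Ass_quotient_iff[OF P] using prime y_in by (auto simp: ann_def)
  moreover have "ann y \<notin> prime_locus R (Q r)"
  proof
    assume "ann y \<in> prime_locus R (Q r)"
    then have "y \<in> colon_ideal M P (Q r)"
      using y_in by (auto simp: prime_locus_def ann_def colon_ideal_def)
    then have "y \<in> colon_ideal M P (Q r [^]\<^bsub>ideals_set R\<^esub> (1::nat))"
      using Q_ideal[of r] by (simp add: R.ideal_prod_commute[OF R.oneideal] R.ideal_prod_one)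
    then show False
      using y_sat saturationI by blast
  qed
  moreover have "b \<in> ann y"
  proof -
    obtain d where d: "d \<in> carrier R" "y = d \<odot>\<^bsub>M\<^esub> x"
      using y by (auto simp: Y_def)
    have "d \<odot>\<^bsub>M\<^esub> (b \<odot>\<^bsub>M\<^esub> (b \<odot>\<^bsub>M\<^esub> x)) \<in> P"
      by (rule submoduleE(4)[OF P d(1) bbx])
    also have "d \<odot>\<^bsub>M\<^esub> (b \<odot>\<^bsub>M\<^esub> (b \<odot>\<^bsub>M\<^esub> x)) = (b \<otimes>\<^bsub>R\<^esub> b) \<odot>\<^bsub>M\<^esub> y"
      using b d x by (simp add: smult_assoc1 smult_commute)
    finally have "b \<otimes>\<^bsub>R\<^esub> b \<in> ann y"
      using b by (simp add: ann_def)
    then show ?thesis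
      using primeideal.I_prime[OF prime b b] by blast
  qed
  ultimately show False
    using outside by blast
qed

text \<open>By (vi) the union is one of equal sets. If a_(j+1) lies in an associated prime p = (q_jM
  : x), then x is in q_jM : a_(j+1) = q_jM : q, which forces q into p.\<close>

lemma relatively_regular_imp_saturation:
  assumes reg: "relatively_regular" and j: "j < r"
  shows "colon_elem M (N j) (a (Suc j)) = saturation (N j)"
    and "\<forall>p \<in> Ass R (quotient_module M (N j)) - prime_locus R (Q r). a (Suc j) \<notin> p"
proof -
  have jr: "j \<le> r" and b: "a (Suc j) \<in> carrier R"
    using j seq_closed by auto
  have colon: "colon_elem M (N j) (a (Suc j)) = colon_ideal M (N j) (Q r [^]\<^bsub>ideals_set R\<^esub> n)"
    if "1 \<le> n" for n :: nat
    using relatively_regular_imp_colon_eq[OF reg j, of 1 n] that b by simp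
  have "saturation (N j) = (\<Union>n\<in>{1::nat..}. colon_elem M (N j) (a (Suc j)))"
    unfolding saturation_def by (rule SUP_cong[OF refl]) (use colon in simp)
  then show "colon_elem M (N j) (a (Suc j)) = saturation (N j)"
    by auto
  show "\<forall>p \<in> Ass R (quotient_module M (N j)) - prime_locus R (Q r). a (Suc j) \<notin> p"
  proof (rule ballI, rule notI)
    fix p assume p: "p \<in> Ass R (quotient_module M (N j)) - prime_locus R (Q r)" "a (Suc j) \<in> p"
    then obtain x where x: "primeideal p R" "x \<in> carrier M" "p = {c \<in> carrier R. c \<odot>\<^bsub>M\<^esub> x \<in> N j}"
      using Ass_quotient_iff[OF N_submodule[OF jr]] by blast
    then have "x \<in> colon_ideal M (N j) (Q r)"
      using p(2) colon[of 1] Q_ideal[of r]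
      by (auto simp: colon_elem_def R.ideal_prod_commute[OF R.oneideal] R.ideal_prod_one)
    then have "Q r \<subseteq> p"
      using ideal.Icarr[OF Q_ideal[of r]] by (auto simp: x(3) colon_ideal_def)
    then show False
      using p(1) x(1) by (simp add: prime_locus_def)
  qed
qed

text \<open>For b = a_(j+1), (vii) puts q_jM : b^2 into the saturation of q_jM, which is q_jM : b.
  It remains to pass from b to every a_i: for i > j, a_i x first lands in q_(i-1)M and is then
  brought down to q_jM.\<close>

lemma saturation_imp_relatively_regular:
  assumes noeth: "noetherian_ring R"
    and sat: "\<And>j. j < r \<Longrightarrow> colon_elem M (N j) (a (Suc j)) = saturation (N j)"
    and outside: "\<And>j. j < r \<Longrightarrow>
      \<forall>p \<in> Ass R (quotient_module M (N j)) - prime_locus R (Q r). a (Suc j) \<notin> p"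
  shows "relatively_regular"
proof (rule relatively_regularI_square)
  have square: "a (Suc k) \<odot>\<^bsub>M\<^esub> z \<in> N k" and square_sat: "z \<in> saturation (N k)"
    if "k < r" "z \<in> carrier M" "a (Suc k) \<odot>\<^bsub>M\<^esub> (a (Suc k) \<odot>\<^bsub>M\<^esub> z) \<in> N k" for k z
  proof -
    show "z \<in> saturation (N k)"
      using that seq_closed[of "Suc k"]
      by (intro in_saturation_if_outside_associated_primes[OF noeth _ _ outside]) (auto simp: N_submodule)
    then show "a (Suc k) \<odot>\<^bsub>M\<^esub> z \<in> N k"
      using sat[OF that(1)] by (auto simp: colon_elem_def)
  qed
  \<comment> \<open>So N_k meets the saturation of N_j in N_j. One step takes w = y + bz with b =
    a_(k+1): w lies in the saturation of N_k as well, hence so does bz, and therefore b^2 z and then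
    bz lie in N_k.\<close>
  have descend: "w \<in> N j" if "j \<le> k" "k \<le> r" "w \<in> N k" "w \<in> saturation (N j)" for j k w
    using that
  proof (induction k rule: dec_induct)
    case (step k)
    let ?b = "a (Suc k)"
    have k: "k \<le> r" "k < r" and b: "?b \<in> carrier R"
      using step.prems seq_closed by auto
    obtain y z where yz: "y \<in> N k" "z \<in> carrier M" "w = y \<oplus>\<^bsub>M\<^esub> ?b \<odot>\<^bsub>M\<^esub> z"
      using N_Suc_split[OF k(2) step.prems(2)] by blast
    note S = submodule_saturation[OF N_submodule[OF k(1)]]
    have "w \<in> saturation (N k)"
      using saturation_mono[OF N_mono[OF step.hyps(1) k(1)]] step.prems(3) by blast
    moreover have "y \<in> saturation (N k)"
      using subset_saturation[OF N_submodule[OF k(1)]] yz(1) by blast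
    ultimately have "?b \<odot>\<^bsub>M\<^esub> z \<in> saturation (N k)"
      using submodule_add_cancel_left[OF S] b yz(2,3) by blast
    then have "?b \<odot>\<^bsub>M\<^esub> (?b \<odot>\<^bsub>M\<^esub> z) \<in> N k"
      using sat[OF k(2)] by (auto simp: colon_elem_def)
    then have "?b \<odot>\<^bsub>M\<^esub> z \<in> N k"
      by (rule square[OF k(2) yz(2)])
    then have "w \<in> N k"
      unfolding yz(3) by (rule submoduleE(5)[OF N_submodule[OF k(1)] yz(1)])
    then show ?case
      using step.IH k(1) step.prems(3) by blast
  qed
  fix j x
  assume j: "j < r" and x: "x \<in> carrier M" and bbx: "a (Suc j) \<odot>\<^bsub>M\<^esub> (a (Suc j) \<odot>\<^bsub>M\<^esub> x) \<in> N j"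
  have jr: "j \<le> r"
    using j by simp
  have x_sat: "x \<in> saturation (N j)"
    by (rule square_sat[OF j x bbx])
  have "a i \<odot>\<^bsub>M\<^esub> x \<in> N j" if i: "i \<in> {1..r}" for i
  proof (cases "i \<le> j")
    case True
    then show ?thesis
      using i generator_smult_in_N[OF _ jr x] by auto
  next
    case False
    then obtain k where k: "i = Suc k" "j \<le> k" "k < r"
      using i by (cases i) auto
    have "x \<in> saturation (N k)"
      using saturation_mono[OF N_mono[of j k]] k x_sat by auto
    then have "a i \<odot>\<^bsub>M\<^esub> x \<in> N k"
      using sat[OF k(3)] k(1) by (auto simp: colon_elem_def)
    moreover have "a i \<odot>\<^bsub>M\<^esub> x \<in> saturation (N j)"
      by (rule submoduleE(4)[OF submodule_saturation[OF N_submodule[OF jr]] seq_closed[OF i] x_sat])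
    ultimately show ?thesis
      using descend k by simp
  qed
  then show "x \<in> colon_ideal M (N j) (Q r)"
    using x by (simp add: colon_ideal_Q[OF N_submodule[OF jr] order_refl])
qed

lemma relatively_regular_iff_saturation:
  assumes "noetherian_ring R"
  shows "relatively_regular \<longleftrightarrow> (\<forall>j<r. colon_elem M (N j) (a (Suc j)) = saturation (N j) \<and>
    (\<forall>p \<in> Ass R (quotient_module M (N j)) - prime_locus R (Q r). a (Suc j) \<notin> p))"
  using relatively_regular_imp_saturation saturation_imp_relatively_regular[OF assms] by blast

end

section \<open>Krull's intersection theorem\<close>

lemma (in module) submodule_Union_chain:
  assumes "C \<noteq> {}" and sub: "\<And>P. P \<in> C \<Longrightarrow> submodule P R M"
    and chain: "\<And>P P'. \<lbrakk>P \<in> C; P' \<in> C\<rbrakk> \<Longrightarrow> P \<subseteq> P' \<or> P' \<subseteq> P"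
  shows "submodule (\<Union>C) R M"
proof (rule submoduleI)
  show "\<Union>C \<subseteq> carrier M"
    using sub submoduleE(1) by blast
  show "\<zero>\<^bsub>M\<^esub> \<in> \<Union>C"
    using assms(1) submodule_zero[OF sub] by blast
  show "\<ominus>\<^bsub>M\<^esub> x \<in> \<Union>C" if "x \<in> \<Union>C" for x
    using that submoduleE(3)[OF sub] by blast
  show "c \<odot>\<^bsub>M\<^esub> x \<in> \<Union>C" if "c \<in> carrier R" "x \<in> \<Union>C" for c x
    using that submoduleE(4)[OF sub] by blast
  show "x \<oplus>\<^bsub>M\<^esub> y \<in> \<Union>C" if xy: "x \<in> \<Union>C" "y \<in> \<Union>C" for x y
  proof -
    obtain P P' where P: "P \<in> C" "x \<in> P" "P' \<in> C" "y \<in> P'"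
      using xy by blast
    then have "x \<in> P' \<or> y \<in> P"
      using chain[of P P'] by blast
    then show ?thesis
      using P submoduleE(5)[OF sub] by blast
  qed
qed

text \<open>Bridge between the index j = i - 1 of the lemmas and the index i of the theorem.\<close>

lemma all_less_iff_ball_interval: "(\<forall>j<r. P j) \<longleftrightarrow> (\<forall>i\<in>{1..r}. P (i - 1))"
  for r :: nat
proof
  show "\<forall>j<r. P j" if P: "\<forall>i\<in>{1..r}. P (i - 1)"
  proof (intro allI impI)
    fix j assume "j < r"
    then show "P j"
      using bspec[OF P, of "Suc j"] by simp
  qed
qed auto

locale sequence_in_local_ring = sequence_in_ring R M a r + noetherian_local_ring R m
  for R (structure) and M (structure) and a r m +
  assumes finitely_generated: "finitely_generated_module R M"
    and seq_in_maximal: "i \<in> {1..r} \<Longrightarrow> a i \<in> m"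
begin

text \<open>
  Instead of the Artin--Rees lemma: if \<open>x \<notin> P\<close>, enlarge \<open>P\<close> to a submodule \<open>W\<close> maximal with
  \<open>m x \<subseteq> W\<close> and \<open>x \<notin> W\<close>. Every element of \<open>M\<close> is then killed modulo \<open>W\<close> by a power of each
  \<open>a\<^sub>i\<close>, so \<open>W\<close> contains some \<open>q\<^sup>n M\<close>.
\<close>

lemma Krull_intersection:
  assumes P: "submodule P R M" and x: "x \<in> carrier M"
    and close: "\<And>n::nat. \<exists>y \<in> P. \<exists>z \<in> (Q r [^]\<^bsub>ideals_set R\<^esub> n) \<star> M. x = y \<oplus>\<^bsub>M\<^esub> z"
  shows "x \<in> P"
proof (rule ccontr)
  assume x_notin: "x \<notin> P"
  have m: "ideal m R"
    using maximal by (simp add: maximalideal_def)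
  \<comment> \<open>Modulo such a \<open>W\<close> the class of x is nonzero and spans a copy of the
    residue field.\<close>
  define F where "F = {W. submodule W R M \<and> P \<subseteq> W \<and> (\<forall>c\<in>m. c \<odot>\<^bsub>M\<^esub> x \<in> W) \<and> x \<notin> W}"
  have "P <+>\<^bsub>M\<^esub> (\<lambda>c. c \<odot>\<^bsub>M\<^esub> x) ` m \<in> F"
  proof -
    let ?W = "P <+>\<^bsub>M\<^esub> (\<lambda>c. c \<odot>\<^bsub>M\<^esub> x) ` m"
    have W_iff: "w \<in> ?W \<longleftrightarrow> (\<exists>y\<in>P. \<exists>c\<in>m. w = y \<oplus>\<^bsub>M\<^esub> c \<odot>\<^bsub>M\<^esub> x)" for w
      unfolding set_add_def' by blast
    have "submodule ?W R M"
      by (rule submodule_set_add[OF P submodule_ideal_image[OF m x]])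
    moreover have "P \<subseteq> ?W"
    proof
      fix y assume y: "y \<in> P"
      have "y = y \<oplus>\<^bsub>M\<^esub> \<zero>\<^bsub>R\<^esub> \<odot>\<^bsub>M\<^esub> x"
        using x submodule_in_carrier[OF P y] by simp
      moreover have "\<zero>\<^bsub>R\<^esub> \<in> m"
        using m by (simp add: ideal_def additive_subgroup.zero_closed)
      ultimately show "y \<in> ?W"
        unfolding W_iff using y by blast
    qed
    moreover have "c \<odot>\<^bsub>M\<^esub> x \<in> ?W" if c: "c \<in> m" for c
    proof -
      have "c \<odot>\<^bsub>M\<^esub> x = \<zero>\<^bsub>M\<^esub> \<oplus>\<^bsub>M\<^esub> c \<odot>\<^bsub>M\<^esub> x"
        using x ideal.Icarr[OF m c] by simp
      then show ?thesis
        unfolding W_iff using c submodule_zero[OF P] by blast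
    qed
    \<comment> \<open>Nakayama in miniature: if x = y + cx with y in \<open>P\<close> and c in
      \<open>m\<close>, then 1 - c carries x into \<open>P\<close>, so both 1 - c and c would lie in
      \<open>m\<close>.\<close>
    moreover have "x \<notin> ?W"
    proof
      assume "x \<in> ?W"
      then obtain y c where yc: "y \<in> P" "c \<in> m" "x = y \<oplus>\<^bsub>M\<^esub> c \<odot>\<^bsub>M\<^esub> x"
        using W_iff by blast
      have c: "c \<in> carrier R" and y: "y \<in> carrier M"
        using ideal.Icarr[OF m yc(2)] submodule_in_carrier[OF P yc(1)] by auto
      let ?d = "\<one>\<^bsub>R\<^esub> \<oplus>\<^bsub>R\<^esub> \<ominus>\<^bsub>R\<^esub> c"
      have "?d \<odot>\<^bsub>M\<^esub> x = x \<oplus>\<^bsub>M\<^esub> \<ominus>\<^bsub>M\<^esub> (c \<odot>\<^bsub>M\<^esub> x)"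
        using c x by (simp add: smult_l_distr smult_l_minus)
      also have "\<dots> = (y \<oplus>\<^bsub>M\<^esub> c \<odot>\<^bsub>M\<^esub> x) \<oplus>\<^bsub>M\<^esub> \<ominus>\<^bsub>M\<^esub> (c \<odot>\<^bsub>M\<^esub> x)"
        using yc(3) by simp
      also have "\<dots> = y"
        using c x y by (simp add: M.a_assoc M.r_neg)
      finally have "?d \<in> {e \<in> carrier R. e \<odot>\<^bsub>M\<^esub> x \<in> P}"
        using c yc(1) by simp
      moreover have "{e \<in> carrier R. e \<odot>\<^bsub>M\<^esub> x \<in> P} \<subseteq> m"
        using x x_notin by (intro proper_ideal_subset_maximal ideal_of_vector_colon[OF P x]) simp
      ultimately have "?d \<in> m"
        by blast
      then have "?d \<oplus>\<^bsub>R\<^esub> c \<in> m"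
        using yc(2) m by (simp add: ideal_def additive_subgroup.a_closed)
      moreover have "?d \<oplus>\<^bsub>R\<^esub> c = \<one>\<^bsub>R\<^esub>"
        using c by (simp add: R.a_assoc R.l_neg)
      ultimately show False
        using one_notin_maximal by simp
    qed
    ultimately show ?thesis
      by (simp add: F_def)
  qed
  then have "F \<noteq> {}"
    by blast
  then have "\<exists>W\<in>F. \<forall>W'\<in>F. W \<subseteq> W' \<longrightarrow> W' = W"
  proof (rule subset_Zorn_nonempty)
    fix C assume C: "C \<noteq> {}" "subset.chain F C"
    then have CF: "C \<subseteq> F"
      by (simp add: pred_on.chain_def)
    have "submodule (\<Union>C) R M"
      using C CF by (intro submodule_Union_chain) (auto simp: pred_on.chain_def F_def)
    then show "\<Union>C \<in> F"
      using C(1) CF unfolding F_def by blast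
  qed
  then obtain W where "W \<in> F" and max: "\<And>W'. \<lbrakk>W' \<in> F; W \<subseteq> W'\<rbrakk> \<Longrightarrow> W' = W"
    by meson
  then have W: "submodule W R M" "P \<subseteq> W" "\<And>c. c \<in> m \<Longrightarrow> c \<odot>\<^bsub>M\<^esub> x \<in> W" "x \<notin> W"
    by (auto simp: F_def)
  \<comment> \<open>With b = a_i, the annihilators of the vectors b^n s modulo \<open>W\<close> grow
    with n. Where two consecutive ones agree, b^n s already lies in \<open>W\<close>.\<close>
  have power_in_W: "\<exists>n::nat. (a i [^]\<^bsub>R\<^esub> n) \<odot>\<^bsub>M\<^esub> s \<in> W" if i: "i \<in> {1..r}" and s: "s \<in> carrier M" for i s
  proof -
    let ?v = "\<lambda>n::nat. (a i [^]\<^bsub>R\<^esub> n) \<odot>\<^bsub>M\<^esub> s"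
    have ai: "a i \<in> carrier R"
      by (rule seq_closed[OF i])
    have v: "?v n \<in> carrier M" for n
      using ai s by simp
    have v_Suc: "?v (Suc n) = a i \<odot>\<^bsub>M\<^esub> ?v n" for n
      using smult_assoc1[OF ai R.nat_pow_closed[OF ai] s] R.nat_pow_Suc2[OF ai] by simp
    define I where "I n = {c \<in> carrier R. c \<odot>\<^bsub>M\<^esub> ?v n \<in> W}" for n
    have "I n \<subseteq> I (Suc n)" for n
    proof
      fix c assume "c \<in> I n"
      then have c: "c \<in> carrier R" "c \<odot>\<^bsub>M\<^esub> ?v n \<in> W"
        by (simp_all only: I_def mem_Collect_eq)
      have "c \<odot>\<^bsub>M\<^esub> ?v (Suc n) \<in> W"
        unfolding v_Suc smult_commute[OF c(1) ai v] by (rule submoduleE(4)[OF W(1) ai c(2)])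
      then show "c \<in> I (Suc n)"
        using c(1) by (simp only: I_def mem_Collect_eq)
    qed
    moreover have "ideal (I n) R" for n
      unfolding I_def by (rule ideal_of_vector_colon[OF W(1) v])
    ultimately obtain n where n: "I (Suc n) = I n"
      using ascending_ideals_stationary[of I] by blast
    have "?v n \<in> W"
    proof (rule ccontr)
      assume notin: "?v n \<notin> W"
      let ?W' = "W <+>\<^bsub>M\<^esub> (\<lambda>c. c \<odot>\<^bsub>M\<^esub> ?v n) ` carrier R"
      have W'_iff: "w \<in> ?W' \<longleftrightarrow> (\<exists>y\<in>W. \<exists>c\<in>carrier R. w = y \<oplus>\<^bsub>M\<^esub> c \<odot>\<^bsub>M\<^esub> ?v n)" for w
        unfolding set_add_def' by blast
      have "y \<in> ?W'" if y: "y \<in> W" for y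
      proof -
        have "y = y \<oplus>\<^bsub>M\<^esub> \<zero>\<^bsub>R\<^esub> \<odot>\<^bsub>M\<^esub> ?v n"
          using v submodule_in_carrier[OF W(1) y] by simp
        then show ?thesis
          unfolding W'_iff using y by blast
      qed
      then have sub: "W \<subseteq> ?W'"
        by blast
      have "?v n = \<zero>\<^bsub>M\<^esub> \<oplus>\<^bsub>M\<^esub> \<one>\<^bsub>R\<^esub> \<odot>\<^bsub>M\<^esub> ?v n"
        using v by simp
      then have "?v n \<in> ?W'"
        unfolding W'_iff using submodule_zero[OF W(1)] by blast
      then have "?W' \<noteq> W"
        using notin by blast
      then have "?W' \<notin> F"
        using max sub by blast
      moreover have "submodule ?W' R M"
        by (rule submodule_set_add[OF W(1) submodule_ideal_image[OF R.oneideal v]])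
      \<comment> \<open>W + R b^n s strictly contains \<open>W\<close> and still contains
        \<open>P\<close> and mx, so only the presence of x can exclude it from
        \<open>F\<close>.\<close>
      ultimately have "x \<in> ?W'"
        using W(2,3) sub by (auto simp: F_def)
      then obtain y c where yc: "y \<in> W" "c \<in> carrier R" "x = y \<oplus>\<^bsub>M\<^esub> c \<odot>\<^bsub>M\<^esub> ?v n"
        using W'_iff by blast
      have y: "y \<in> carrier M"
        by (rule submodule_in_carrier[OF W(1) yc(1)])
      \<comment> \<open>Multiply x = y + c b^n s by b. Since b is in \<open>m\<close>, bx lies in
        \<open>W\<close>, hence so does c b^(n+1) s; stationarity removes one factor b, and x falls
        into \<open>W\<close>.\<close>
      have "a i \<odot>\<^bsub>M\<^esub> x = a i \<odot>\<^bsub>M\<^esub> y \<oplus>\<^bsub>M\<^esub> c \<odot>\<^bsub>M\<^esub> ?v (Suc n)"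
        unfolding v_Suc yc(3) smult_commute[OF yc(2) ai v]
        by (rule smult_r_distr[OF ai y smult_closed[OF yc(2) v]])
      then have "a i \<odot>\<^bsub>M\<^esub> y \<oplus>\<^bsub>M\<^esub> c \<odot>\<^bsub>M\<^esub> ?v (Suc n) \<in> W"
        using W(3)[OF seq_in_maximal[OF i]] by simp
      then have "c \<odot>\<^bsub>M\<^esub> ?v (Suc n) \<in> W"
        by (rule submodule_add_cancel_left[OF W(1) smult_closed[OF yc(2) v]
              submoduleE(4)[OF W(1) ai yc(1)]])
      then have "c \<in> I (Suc n)"
        using yc(2) by (simp only: I_def mem_Collect_eq)
      then have "c \<odot>\<^bsub>M\<^esub> ?v n \<in> W"
        unfolding n by (simp only: I_def mem_Collect_eq)
      then have "x \<in> W"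
        unfolding yc(3) by (rule submoduleE(5)[OF W(1) yc(1)])
      then show False
        using W(4) by blast
    qed
    then show ?thesis ..
  qed
  have saturated: "carrier M \<subseteq> saturation W"
  proof
    fix s assume s: "s \<in> carrier M"
    then show "s \<in> saturation W"
      using power_in_W subset_saturation[OF W(1)]
      by (intro saturationI_generator_powers[OF W(1)]) blast+
  qed
  obtain S where S: "finite S" "S \<subseteq> carrier M" "\<Inter>{V. submodule V R M \<and> S \<subseteq> V} = carrier M"
    using finitely_generated by (auto simp: finitely_generated_module_def)
  \<comment> \<open>Finite generation makes the exponent uniform on M, so \<open>W\<close> contains
    q^n M, which contradicts \<open>close\<close>.\<close>
  obtain n :: nat where "S \<subseteq> colon_ideal M W (Q r [^]\<^bsub>ideals_set R\<^esub> n)"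
    using finite_subset_saturation[OF S(1) subset_trans[OF S(2) saturated]] by blast
  then have n: "carrier M \<subseteq> colon_ideal M W (Q r [^]\<^bsub>ideals_set R\<^esub> n)"
    using S(3) submodule_colon_Q_power[OF W(1)] by blast
  have "z \<in> W" if "z \<in> (Q r [^]\<^bsub>ideals_set R\<^esub> n) \<star> M" for z
    using that by induction (use n submoduleE(5)[OF W(1)] in \<open>auto simp: colon_ideal_def\<close>)
  then have "x \<in> W"
    using close[of n] W(2) submoduleE(5)[OF W(1)] by blast
  then show False
    using W(4) by blast
qed

text \<open>If bx lies in q_jM, it lies in q_jM + q^(s n + 1) M for every n, so superficiality puts
  x into q_jM + q^(s n) M. As s n >= n, Krull's theorem applies. This serves (i) and (ii)
  alike.\<close>

lemma superficial_at_imp_relatively_regular: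
  assumes "\<forall>j<r. \<exists>s :: nat \<Rightarrow> nat. strict_mono s \<and> (\<forall>k. superficial_at j (s k))"
  shows "relatively_regular"
  unfolding relatively_regular_def
proof (intro allI impI ballI)
  fix j x assume j: "j < r" and x: "x \<in> N r" and bx: "a (Suc j) \<odot>\<^bsub>M\<^esub> x \<in> N j"
  have jr: "j \<le> r"
    using j by simp
  have x_in: "x \<in> carrier M"
    by (rule N_in_carrier[OF order_refl x])
  note E_iff = ideal_smult_add_iff[OF Q_ideal[OF jr] Q_power_ideal]
  obtain s :: "nat \<Rightarrow> nat" where s: "strict_mono s" "\<And>k. superficial_at j (s k)"
    using assms j by blast
  show "x \<in> N j"
  proof (rule Krull_intersection[OF N_submodule[OF jr] x_in])
    fix n :: nat
    have "a (Suc j) \<odot>\<^bsub>M\<^esub> x = a (Suc j) \<odot>\<^bsub>M\<^esub> x \<oplus>\<^bsub>M\<^esub> \<zero>\<^bsub>M\<^esub>"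
      using N_in_carrier[OF jr bx] by simp
    then have "a (Suc j) \<odot>\<^bsub>M\<^esub> x \<in> (Q j <+>\<^bsub>R\<^esub> (Q r [^]\<^bsub>ideals_set R\<^esub> (s n + 1))) \<star> M"
      unfolding E_iff using bx submodule_zero[OF submodule_ideal_smult[OF Q_power_ideal]] by blast
    then have "x \<in> (Q j <+>\<^bsub>R\<^esub> (Q r [^]\<^bsub>ideals_set R\<^esub> s n)) \<star> M"
      using s(2)[of n] x x_in unfolding superficial_at_def colon_elem_def by blast
    then obtain y z where yz: "y \<in> N j" "z \<in> (Q r [^]\<^bsub>ideals_set R\<^esub> s n) \<star> M" "x = y \<oplus>\<^bsub>M\<^esub> z"
      unfolding E_iff by blast
    have "Q r [^]\<^bsub>ideals_set R\<^esub> s n \<subseteq> Q r [^]\<^bsub>ideals_set R\<^esub> n"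
      by (rule R.ideal_power_antimono[OF Q_ideal[OF order_refl] strict_mono_imp_increasing[OF s(1)]])
    then have "z \<in> (Q r [^]\<^bsub>ideals_set R\<^esub> n) \<star> M"
      using yz(2) ideal_smult_mono by blast
    then show "\<exists>y \<in> N j. \<exists>z \<in> (Q r [^]\<^bsub>ideals_set R\<^esub> n) \<star> M. x = y \<oplus>\<^bsub>M\<^esub> z"
      using yz(1,3) by blast
  qed
qed

lemma relatively_regular_iff_infinitely_often_superficial:
  "relatively_regular \<longleftrightarrow>
    (\<forall>j<r. \<exists>s :: nat \<Rightarrow> nat. strict_mono s \<and> (\<forall>k. 0 < s k \<and> superficial_at j (s k)))"
    (is "_ \<longleftrightarrow> ?C")
proof
  show ?C if "relatively_regular"
  proof (intro allI impI)
    fix j assume "j < r"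
    \<comment> \<open>The witness is \<open>Suc\<close>: under regularity every positive exponent is
      superficial.\<close>
    then show "\<exists>s :: nat \<Rightarrow> nat. strict_mono s \<and> (\<forall>k. 0 < s k \<and> superficial_at j (s k))"
      using relatively_regular_imp_superficial_at[OF that]
      by (intro exI[of _ Suc]) (simp add: strict_mono_Suc_iff)
  qed
  show "relatively_regular" if ?C
    using that by (intro superficial_at_imp_relatively_regular) blast
qed

lemma relatively_regular_iff_eventually_superficial:
  "relatively_regular \<longleftrightarrow> (\<forall>j<r. \<forall>\<^sub>F n in sequentially. superficial_at j n)"
    (is "_ \<longleftrightarrow> ?C")
proof
  show ?C if "relatively_regular"
  proof (intro allI impI)
    fix j assume j: "j < r"
    show "\<forall>\<^sub>F n in sequentially. superficial_at j n"
      using eventually_gt_at_top[of "0::nat"]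
      by eventually_elim (use relatively_regular_imp_superficial_at[OF that j] gr0_conv_Suc in auto)
  qed
  show "relatively_regular" if C: ?C
  proof (rule superficial_at_imp_relatively_regular, intro allI impI)
    fix j assume "j < r"
    then obtain n where "\<forall>k\<ge>n. superficial_at j k"
      using C eventually_sequentially by auto
    then show "\<exists>s :: nat \<Rightarrow> nat. strict_mono s \<and> (\<forall>k. superficial_at j (s k))"
      by (intro exI[of _ "\<lambda>k. k + n"]) (simp add: strict_mono_def)
  qed
qed

lemma absolutely_superficial_iff:
  "absolutely_superficial R m M r a \<longleftrightarrow> relatively_regular"
proof -
  \<comment> \<open>\<open>j\<close> and \<open>b\<close> are kept independent so that one formula
    covers both \<open>E (i - 1) (a i)\<close> and \<open>E j (a (Suc j))\<close>.\<close>
  define E where "E j b \<longleftrightarrow> (\<forall>\<^sub>F n in sequentially.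
      colon_elem (quotient_module M (N j))
        ((Q r [^]\<^bsub>ideals_set R\<^esub> (n + 1)) \<star> quotient_module M (N j)) b \<inter>
        Q r \<star> quotient_module M (N j) =
      (Q r [^]\<^bsub>ideals_set R\<^esub> n) \<star> quotient_module M (N j))" for j b
  have E: "E j (a (Suc j)) \<longleftrightarrow> (\<forall>\<^sub>F n in sequentially. superficial_at j n)" if j: "j < r" for j
  proof -
    have "j \<le> r" and b: "a (Suc j) \<in> carrier R"
      using j seq_closed by auto
    then show ?thesis
      unfolding E_def superficial_at_def
        quotient_colon_eq_iff[OF Q_ideal[OF \<open>j \<le> r\<close>] Q_power_ideal Q_ideal[OF order_refl] Q_power_ideal b]
      by (simp only: Q_add_absorb)
  qed
  have "absolutely_superficial R m M r a \<longleftrightarrow> (\<forall>i\<in>{1..r}. E (i - 1) (a i))"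
    unfolding absolutely_superficial_def Let_def E_def Q_def using seq_in_maximal by blast
  also have "\<dots> \<longleftrightarrow> (\<forall>j<r. E j (a (Suc j)))"
    by (simp add: all_less_iff_ball_interval)
  also have "\<dots> \<longleftrightarrow> (\<forall>j<r. \<forall>\<^sub>F n in sequentially. superficial_at j n)"
    using E by simp
  finally show ?thesis
    unfolding relatively_regular_iff_eventually_superficial .
qed

end


theorem theorem1p1:
  fixes A :: "('a, 'c) ring_scheme"
    and M :: "('a, 'b, 'd) module_scheme"
    and m :: "'a set"
    and a :: "nat \<Rightarrow> 'a"
    and r :: nat
    and qq :: "nat \<Rightarrow> 'a set"
    and q :: "'a set"
  assumes "noetherian_local_ring A m"
    and "module A M"
    and "finitely_generated_module A M"
    and "\<And>i. i \<in> {1..r} \<Longrightarrow> a i \<in> m"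
    and "qq = (\<lambda>i. Idl\<^bsub>A\<^esub> (a ` {1..i}))"
    and "q = qq r"
  shows "all_equivalent
    [ absolutely_superficial A m M r a,

      \<forall>i\<in>{1..r}. \<exists>s :: nat \<Rightarrow> nat. strict_mono s \<and> (\<forall>k. 0 < s k \<and>
        colon_elem M ((qq (i - 1) <+>\<^bsub>A\<^esub> (q [^]\<^bsub>ideals_set A\<^esub> (s k + 1))) \<star> M) (a i) \<inter> q \<star> M =
        (qq (i - 1) <+>\<^bsub>A\<^esub> (q [^]\<^bsub>ideals_set A\<^esub> s k)) \<star> M),

      \<forall>n :: nat. \<forall>i\<in>{1..r}.
        colon_elem M (qq (i - 1) \<star> M) (a i) \<inter>
          (q \<cdot>\<^bsub>A\<^esub> ((Idl\<^bsub>A\<^esub> (a ` {i..r})) [^]\<^bsub>ideals_set A\<^esub> n)) \<star> M =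
        (qq (i - 1) \<cdot>\<^bsub>A\<^esub> ((Idl\<^bsub>A\<^esub> (a ` {i..r})) [^]\<^bsub>ideals_set A\<^esub> n)) \<star> M,

      \<forall>i\<in>{1..r}. colon_elem M (qq (i - 1) \<star> M) (a i) \<inter> q \<star> M = qq (i - 1) \<star> M,

      \<forall>i\<in>{1..r}. colon_elem M (qq (i - 1) \<star> M) (a i [^]\<^bsub>A\<^esub> (2::nat)) =
        colon_ideal M (qq (i - 1) \<star> M) q,

      \<forall>k\<ge>1. \<forall>n\<ge>1. \<forall>i\<in>{1..r}.
        colon_elem M (qq (i - 1) \<star> M) (a i [^]\<^bsub>A\<^esub> (k::nat)) =
        colon_ideal M (qq (i - 1) \<star> M) (q [^]\<^bsub>ideals_set A\<^esub> (n::nat)),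

      \<forall>i\<in>{1..r}.
        colon_elem M (qq (i - 1) \<star> M) (a i) =
          (\<Union>n\<in>{1::nat..}. colon_ideal M (qq (i - 1) \<star> M) (q [^]\<^bsub>ideals_set A\<^esub> n)) \<and>
        (\<forall>p \<in> Ass A (quotient_module M (qq (i - 1) \<star> M)) - prime_locus A q. a i \<notin> p) ]"
proof -
  interpret noetherian_local_ring A m by fact
  interpret module A M by fact
  have m: "ideal m A"
    using maximal by (simp add: maximalideal_def)
  interpret sequence_in_local_ring A M a r m
    using assms(3,4) ideal.Icarr[OF m]
    by unfold_locales auto
  have qq: "qq = Q"
    by (simp add: assms(5) Q_def fun_eq_iff)
  have Suc_pred: "Suc (i - 1) = i" if "i \<in> {1..r}" for i
    using that by simp
  \<comment> \<open>\<open>T (i - 1)\<close> unfolds to the interval from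
    \<open>Suc (i - 1)\<close>, which \<open>Suc_pred\<close> turns into i.\<close>
  note shift = all_less_iff_ball_interval T_def Suc_pred
  \<comment> \<open>The equivalences form a star around \<open>relatively_regular\<close> rather
    than a cycle of implications.\<close>
  have all_equivalentI: "all_equivalent Ps" if "\<forall>P\<in>set Ps. P \<longleftrightarrow> relatively_regular" for Ps
    using that unfolding all_equivalent_def by blast
  show ?thesis
    unfolding assms(6) qq
  proof (rule all_equivalentI, simp only: list.set ball_simps simp_thms, intro conjI)
    show "absolutely_superficial A m M r a \<longleftrightarrow> relatively_regular"
      by (rule absolutely_superficial_iff)
  qed (simp only: relatively_regular_iff_infinitely_often_superficial superficial_at_def shift cong: ball_cong,
      simp only: relatively_regular_iff_power_colon shift cong: ball_cong,
      simp only: relatively_regular_iff_colon shift cong: ball_cong,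
      simp only: relatively_regular_iff_colon_square shift cong: ball_cong,
      simp only: relatively_regular_iff_colon_powers shift cong: ball_cong,
      simp only: relatively_regular_iff_saturation[OF noetherian_ring_axioms] saturation_def shift
        cong: ball_cong)
qed

end
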